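(* For $m\in\mathbb Z$ let $R_m(q)=\sum_{\lambda:\ \rho(\lambda)=m}q^{|\lambda|}$ be the generating function for partitions of pairing rank $m$. Coefficientwise as a formal power series in $q$, $$\lim_{k\to\infty}\det\bigl(R_{i-j}(q)\bigr)_{1\leq i,j\leq k}=\prod_{r\geq1}\frac{1}{(1-q^{2r+1})^r}.$$ The identity also holds analytically for $|q|<1$ (i.e. for each complex $q$ with $|q|<1$ the determinants converge to the product).
   Context: For a partition $\lambda$, let $r(\lambda)$ be the largest part size of multiplicity at least $2$ ($r(\lambda)=0$ if $\lambda$ has distinct parts). Let $u_1>u_2>\cdots$ be the part sizes occurring with odd multiplicity, each taken once, and let $s(\lambda)=u_1-u_2+u_3-u_4+\cdots$ ($0$ if there are none). The pairing rank is $\rho(\lambda)=r(\lambda)-s(\lambda)$. Coefficientwise limit means that for each $N$ the coefficient of $q^N$ is eventually constant in $k$ and equal to that of the right-hand side. *)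

theory Defs
  imports
    "HOL-Library.Multiset"
    "HOL-Computational_Algebra.Formal_Power_Series"
    "HOL-Analysis.Infinite_Sum"
    "HOL-Analysis.Infinite_Products"
    "Jordan_Normal_Form.Determinant"
begin

text \<open>A partition is the multiset of its (positive) parts; its size is \<open>sum_mset p\<close>, whereas
  \<open>size p\<close> is its number of parts.\<close>

definition is_partition :: "nat multiset \<Rightarrow> bool" where
  "is_partition p \<longleftrightarrow> 0 \<notin># p"

definition largest_repeated_part :: "nat multiset \<Rightarrow> nat" where
  "largest_repeated_part p = Max (insert 0 {i \<in> set_mset p. 2 \<le> count p i})"

definition odd_mult_parts :: "nat multiset \<Rightarrow> nat list" where
  "odd_mult_parts p = rev (sorted_list_of_set {i \<in> set_mset p. odd (count p i)})"

definition alternating_sum :: "nat list \<Rightarrow> int" where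
  "alternating_sum us = (\<Sum>i<length us. (-1) ^ i * int (us ! i))"

definition pairing_rank :: "nat multiset \<Rightarrow> int" where
  "pairing_rank p = int (largest_repeated_part p) - alternating_sum (odd_mult_parts p)"

definition partitions_of_rank :: "int \<Rightarrow> nat multiset set" where
  "partitions_of_rank m = {p. is_partition p \<and> pairing_rank p = m}"

text \<open>The cardinality below is that of a finite set, so it is a genuine count.\<close>

lemma finite_partitions_of_rank: "finite {p \<in> partitions_of_rank m. sum_mset p = n}"
proof (rule finite_subset)
  show "finite (mset ` {xs. set xs \<subseteq> {..n} \<and> length xs \<le> n})"
    by (intro finite_imageI finite_lists_length_le) simp
  show "{p \<in> partitions_of_rank m. sum_mset p = n}
        \<subseteq> mset ` {xs. set xs \<subseteq> {..n} \<and> length xs \<le> n}"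
  proof
    fix p assume "p \<in> {p \<in> partitions_of_rank m. sum_mset p = n}"
    then have p: "0 \<notin># p" "sum_mset p = n"
      by (auto simp: partitions_of_rank_def is_partition_def)
    obtain xs where xs: "mset xs = p" using ex_mset by blast
    have "size q \<le> sum_mset q" if "0 \<notin># q" for q :: "nat multiset"
      using that by (induction q) auto
    then have "length xs \<le> n" using p xs by (metis size_mset)
    moreover have "set xs \<subseteq> {..n}"
    proof
      fix x assume "x \<in> set xs"
      then have "x \<in># p" using xs by auto
      then obtain q where "p = add_mset x q" by (meson multi_member_split)
      then show "x \<in> {..n}" using p by auto
    qed
    ultimately show "p \<in> mset ` {xs. set xs \<subseteq> {..n} \<and> length xs \<le> n}"
      using xs by auto
  qed
qed

text \<open>\<open>rank_gf m\<close> is $R_m(q)$ as a formal power series; \<open>rank_gf_value m q\<close> is its value at the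
  complex number \<open>q\<close>, given as the sum over partitions itself.\<close>

definition rank_gf :: "int \<Rightarrow> rat fps" where
  "rank_gf m = Abs_fps (\<lambda>n. of_nat (card {p \<in> partitions_of_rank m. sum_mset p = n}))"

definition rank_gf_value :: "int \<Rightarrow> complex \<Rightarrow> complex" where
  "rank_gf_value m q = (\<Sum>\<^sub>\<infinity>p\<in>partitions_of_rank m. q ^ sum_mset p)"

text \<open>Row and column indices of \<open>mat\<close> start at 0, which leaves \<open>i - j\<close> unchanged.\<close>

definition toeplitz_det :: "nat \<Rightarrow> (int \<Rightarrow> 'a :: comm_ring_1) \<Rightarrow> 'a" where
  "toeplitz_det k a = Determinant.det (Matrix.mat k k (\<lambda>(i, j). a (int i - int j)))"

text \<open>The \<open>n\<close>-th factor of each infinite product is the one for \<open>r = n + 1\<close>. Convergence of formal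
  power series in \<open>prodinf\<close> is with respect to the library's \<open>q\<close>-adic metric.\<close>

definition product_factor_fps :: "nat \<Rightarrow> rat fps" where
  "product_factor_fps n = inverse ((1 - fps_X ^ (2 * (n + 1) + 1)) ^ (n + 1))"

definition product_factor :: "complex \<Rightarrow> nat \<Rightarrow> complex" where
  "product_factor q n = 1 / (1 - q ^ (2 * (n + 1) + 1)) ^ (n + 1)"

end

theory Submission
  imports Defs "HOL-Analysis.FPS_Convergence"
begin

text \<open>A partition is the disjoint union of two copies of an arbitrary partition and a set of distinct parts;
  its pairing rank is the largest part of the former minus the alternating sum of the latter.  With
  \<open>t = q\<^sup>2\<close> this gives the Wiener--Hopf factorisation
  \<open>(\<Sum>m. R m * z ^ m) = f z * g (1 / z)\<close> where \<open>f z = (\<Prod>n\<ge>1. 1 / (1 - t ^ n * z))\<close> and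
  \<open>g z = (\<Prod>n\<ge>0. 1 / (1 - q * t ^ n * z))\<close>.  If \<open>f\<close> is truncated to its first \<open>k\<close> factors, with poles at the
  inverses of \<open>x\<close> in \<open>{t, \<dots>, t ^ k}\<close>, the \<open>k \<times> k\<close> Toeplitz determinant is exactly the product of the
  \<open>g x\<close>, and the functional equation \<open>(1 - q * x) * g x = g (t * x)\<close> evaluates that product.  Formally the
  truncation does not affect low coefficients; analytically it is a perturbation of size
  \<open>\<bar>t\<bar> ^ k\<close>, under which the determinants are stable.\<close>

section \<open>Toeplitz determinants of rational symbols\<close>

text \<open>The analytic half is hard because the order \<open>k\<close> of the determinant grows
  together with the truncation of \<open>f\<close>, so convergence of the entries is not enough.
  Multiplying by the inverse triangular matrices of \<open>f\<close> and \<open>g\<close> first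
  brings the matrix to the identity plus a summable error, with row sums at most
  \<open>1 + \<beta> i\<close>; after that, a perturbation exponentially small in \<open>k\<close>
  outweighs the \<open>k\<close> rows and columns. The exponent \<open>r\<close> in the product is a
  multiplicity. The nodes are \<open>t ^ 1, ..., t ^ k\<close>, and carrying the value of
  \<open>g\<close> from \<open>t ^ j\<close> to \<open>t ^ (k + 1)\<close> consumes the factors
  \<open>1 - q * t ^ r = 1 - q ^ (2 * r + 1)\<close> with \<open>j \<le> r \<le> k\<close>; each is
  therefore used for \<open>r\<close> values of \<open>j\<close>. What remains is the
  \<open>k\<close>-th power of \<open>g\<close> at \<open>t ^ (k + 1)\<close>, which tends to 1. The
  determinant formula holds for every polynomial in \<open>1 / z\<close>, so \<open>g\<close> enters
  through its partial sums. The point \<open>q = 0\<close> is separate, since the nodes coincide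
  there and the Vandermonde argument breaks down.\<close>

definition geometric_fps :: "'a :: comm_ring_1 \<Rightarrow> 'a fps" where
  "geometric_fps x = Abs_fps (\<lambda>m. x ^ m)"

text \<open>Extension by 0 to negative indices turns the Toeplitz matrix of a power series into a
  lower triangular one.\<close>

definition int_coeff :: "'a :: zero fps \<Rightarrow> int \<Rightarrow> 'a" where
  "int_coeff F m = (if m < 0 then 0 else fps_nth F (nat m))"

lemma fps_nth_geometric_fps [simp]: "fps_nth (geometric_fps x) m = x ^ m"
  by (simp add: geometric_fps_def)

lemma fps_nth_prod_geometric_0 [simp]:
  "fps_nth (\<Prod>s\<in>S. geometric_fps (x s)) 0 = (1 :: 'a :: comm_ring_1)"
  by (induction S rule: infinite_finite_induct) auto

lemma linear_times_geometric_fps: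
  "(1 - fps_const x * fps_X) * geometric_fps x = (1 :: 'a :: comm_ring_1 fps)"
proof (rule fps_ext)
  fix n show "fps_nth ((1 - fps_const x * fps_X) * geometric_fps x) n = fps_nth 1 n"
    by (cases n) (simp_all add: left_diff_distrib mult.assoc)
qed

lemma fps_nth_prod_linear_eq_0:
  fixes x :: "'b \<Rightarrow> 'a :: comm_ring_1"
  assumes "finite S" "card S < i"
  shows "fps_nth (\<Prod>s\<in>S. 1 - fps_const (x s) * fps_X) i = 0"
  using assms
proof (induction S arbitrary: i rule: finite_induct)
  case (insert a S)
  obtain j where i: "i = Suc j" using insert.prems by (cases i) auto
  have "card S < i" "card S < j" using insert i by auto
  then show ?case
    using insert.IH i insert.hyps by (simp add: left_diff_distrib mult.assoc)
qed auto

lemma prod_linear_remove_times_prod_geometric: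
  fixes x :: "nat \<Rightarrow> 'a :: comm_ring_1"
  assumes "s < n"
  shows "(\<Prod>t\<in>{..<n} - {s}. 1 - fps_const (x t) * fps_X) * (\<Prod>t<n. geometric_fps (x t))
           = geometric_fps (x s)"
proof -
  have "(\<Prod>t<n. geometric_fps (x t)) = geometric_fps (x s) * (\<Prod>t\<in>{..<n} - {s}. geometric_fps (x t))"
    using assms by (subst prod.remove[of _ s]) auto
  moreover have "(\<Prod>t\<in>{..<n} - {s}. 1 - fps_const (x t) * fps_X)
      * (\<Prod>t\<in>{..<n} - {s}. geometric_fps (x t)) = 1"
    by (simp add: prod.distrib[symmetric] linear_times_geometric_fps)
  ultimately show ?thesis by (simp add: mult.left_commute)
qed

text \<open>A Cauchy product over a range of length \<open>n\<close> that does not depend on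
  \<open>M\<close>, as it occurs in a row-by-column product of matrices. If \<open>n\<close> exceeds
  \<open>M + 1\<close>, the surplus terms vanish by the convention for negative indices; if it falls
  short, the missing ones vanish by the degree of \<open>P\<close>.\<close>

lemma fps_nth_mult_truncated:
  fixes P F :: "'a :: comm_ring_1 fps"
  assumes "\<And>i. n \<le> i \<Longrightarrow> fps_nth P i = 0"
  shows "(\<Sum>i<n. fps_nth P i * int_coeff F (int M - int i)) = fps_nth (P * F) M"
proof -
  have "(\<Sum>i<n. fps_nth P i * int_coeff F (int M - int i))
      = (\<Sum>i\<in>{..<n} \<inter> {..M}. fps_nth P i * int_coeff F (int M - int i))"
    by (rule sum.mono_neutral_right) (auto simp: int_coeff_def)
  also have "\<dots> = (\<Sum>i\<le>M. fps_nth P i * int_coeff F (int M - int i))"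
  proof (rule sum.mono_neutral_left)
    show "\<forall>i\<in>{..M} - {..<n} \<inter> {..M}. fps_nth P i * int_coeff F (int M - int i) = 0"
    proof
      fix i assume "i \<in> {..M} - {..<n} \<inter> {..M}"
      then have "n \<le> i" by auto
      then show "fps_nth P i * int_coeff F (int M - int i) = 0" using assms by simp
    qed
  qed auto
  also have "\<dots> = (\<Sum>i\<le>M. fps_nth P i * fps_nth F (M - i))"
    by (intro sum.cong) (auto simp: int_coeff_def nat_diff_distrib simp flip: of_nat_diff)
  finally show ?thesis by (simp add: fps_mult_nth atLeast0AtMost)
qed

text \<open>A kernel vector would be the coefficient list of a nonzero polynomial of degree below
  \<open>n\<close> with the \<open>n\<close> roots \<open>x s\<close>. The exponents run downwards
  because that is the order in which they arise from the Toeplitz columns.\<close>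

lemma det_vandermonde_neq_0:
  fixes x :: "nat \<Rightarrow> 'a :: idom"
  assumes inj: "inj_on x {..<n}"
  shows "Determinant.det (Matrix.mat n n (\<lambda>(s, j). x s ^ (n - 1 - j))) \<noteq> 0" (is "Determinant.det ?V \<noteq> 0")
proof
  assume "Determinant.det ?V = 0"
  moreover have V: "?V \<in> carrier_mat n n" by simp
  ultimately obtain v where v: "v \<in> carrier_vec n" "v \<noteq> 0\<^sub>v n" "?V *\<^sub>v v = 0\<^sub>v n"
    using det_0_iff_vec_prod_zero[OF V] by blast
  define p where "p = (\<Sum>j<n. Polynomial.monom (vec_index v j) (n - 1 - j))"
  have coeff: "Polynomial.coeff p (n - 1 - j) = vec_index v j" if "j < n" for j
  proof -
    have "Polynomial.coeff p (n - 1 - j) = (\<Sum>i<n. if i = j then vec_index v i else 0)"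
      unfolding p_def coeff_sum
    proof (rule sum.cong)
      fix i assume "i \<in> {..<n}"
      then have "n - 1 - i = n - 1 - j \<longleftrightarrow> i = j" using that by auto
      then show "Polynomial.coeff (Polynomial.monom (vec_index v i) (n - 1 - i)) (n - 1 - j)
          = (if i = j then vec_index v i else 0)" by (simp only: coeff_monom)
    qed simp
    then show ?thesis using that by simp
  qed
  obtain j where j: "j < n" "vec_index v j \<noteq> 0"
    using v(1,2) by (metis carrier_vecD eq_vecI index_zero_vec)
  have "p \<noteq> 0" using coeff[OF j(1)] j(2) by auto
  have "degree p \<le> n - 1" unfolding p_def
    by (intro degree_sum_le) (auto intro: order.trans[OF degree_monom_le])
  have "poly p (x s) = 0" if "s < n" for s
  proof -
    have "vec_index (?V *\<^sub>v v) s = 0" using that v(3) by simp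
    then show ?thesis using that v(1)
      by (simp add: p_def poly_sum poly_monom scalar_prod_def atLeast0LessThan mult.commute)
  qed
  then have "x ` {..<n} \<subseteq> {a. poly p a = 0}" by auto
  then have "card (x ` {..<n}) \<le> degree p"
    using card_mono[OF poly_roots_finite[OF \<open>p \<noteq> 0\<close>]] card_poly_roots_bound[OF \<open>p \<noteq> 0\<close>]
      order.trans by blast
  then show False using card_image[OF inj] \<open>degree p \<le> n - 1\<close> j(1) by auto
qed

lemma toeplitz_det_unipotent:
  assumes "fps_nth F 0 = (1 :: 'a :: comm_ring_1)"
  shows "toeplitz_det n (int_coeff F) = 1"
proof -
  have "toeplitz_det n (int_coeff F) = prod_list (diag_mat (Matrix.mat n n (\<lambda>(i, j). int_coeff F (int i - int j))))"
    unfolding toeplitz_det_def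
    by (rule det_lower_triangular[of n]) (auto simp: int_coeff_def)
  also have "diag_mat (Matrix.mat n n (\<lambda>(i, j). int_coeff F (int i - int j))) = map (\<lambda>_. 1) [0..<n]"
    unfolding diag_mat_def by (intro map_cong) (auto simp: int_coeff_def assms)
  also have "prod_list \<dots> = 1" by (simp add: map_replicate_const)
  finally show ?thesis .
qed

text \<open>The Toeplitz matrix of the symbol \<open>g (1/z) / (\<Prod>s<n. 1 - x s z)\<close> is diagonalised by pairing its
  rows, in reverse order, with the coefficients of the polynomials that omit one of the \<open>n\<close> factors.\<close>

theorem toeplitz_det_rational_symbol:
  fixes x :: "nat \<Rightarrow> 'a :: idom" and g :: "nat \<Rightarrow> 'a"
  assumes inj: "inj_on x {..<n}"
  defines "F \<equiv> (\<Prod>s<n. geometric_fps (x s))"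
  shows "toeplitz_det n (\<lambda>m. \<Sum>l\<le>L. int_coeff F (m + int l) * g l) = (\<Prod>s<n. \<Sum>l\<le>L. g l * x s ^ l)"
proof -
  define w where "w s = (\<Prod>t\<in>{..<n} - {s}. 1 - fps_const (x t) * fps_X)" for s
  define W where "W = Matrix.mat n n (\<lambda>(s, i). fps_nth (w s) (n - 1 - i))"
  define V where "V = Matrix.mat n n (\<lambda>(s, j). x s ^ (n - 1 - j))"
  define T where "T g L = Matrix.mat n n (\<lambda>(i, j). \<Sum>l\<le>L. int_coeff F (int i - int j + int l) * g l)"
    for g :: "nat \<Rightarrow> 'a" and L :: nat
  have W0: "fps_nth (w s) i = 0" if "s < n" "n \<le> i" for s i
    unfolding w_def by (rule fps_nth_prod_linear_eq_0) (use that in \<open>auto simp: card_Diff_singleton\<close>)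
  have row: "W * T g L = mat_diag n (\<lambda>s. \<Sum>l\<le>L. g l * x s ^ l) * V" for g L
  proof (subst mat_diag_mult_left[of _ _ n], simp add: V_def, rule eq_matI, goal_cases)
    case (1 s j)
    then have s: "s < n" and j: "j < n" by auto
    have "(W * T g L) $$ (s, j)
        = (\<Sum>i<n. fps_nth (w s) (n - 1 - i) * (\<Sum>l\<le>L. int_coeff F (int i - int j + int l) * g l))"
      using s j by (simp add: W_def T_def scalar_prod_def atLeast0LessThan)
    also have "\<dots> = (\<Sum>i<n. fps_nth (w s) i * (\<Sum>l\<le>L. int_coeff F (int (n - 1 - i) - int j + int l) * g l))"
      by (rule sum.reindex_bij_witness[of _ "\<lambda>i. n - 1 - i" "\<lambda>i. n - 1 - i"]) auto
    also have "\<dots> = (\<Sum>i<n. \<Sum>l\<le>L. g l * (fps_nth (w s) i * int_coeff F (int (n - 1 - j + l) - int i)))"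
      unfolding sum_distrib_left using j
      by (intro sum.cong refl) (auto simp: of_nat_diff algebra_simps)
    also have "\<dots> = (\<Sum>l\<le>L. g l * (\<Sum>i<n. fps_nth (w s) i * int_coeff F (int (n - 1 - j + l) - int i)))"
      by (subst sum.swap) (simp add: sum_distrib_left)
    \<comment> \<open>Multiplying \<open>F\<close> by \<open>w s\<close> cancels every factor except
      that of \<open>x s\<close>, so each inner sum is a coefficient of a single geometric
      series.\<close>
    also have "\<dots> = (\<Sum>l\<le>L. g l * x s ^ (n - 1 - j + l))"
    proof (intro sum.cong refl arg_cong2[of _ _ _ _ "(*)"], goal_cases)
      case (1 l)
      have "w s * F = geometric_fps (x s)"
        unfolding w_def F_def by (rule prod_linear_remove_times_prod_geometric[OF s])
      then show ?case by (subst fps_nth_mult_truncated[OF W0[OF s]]) simp_all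
    qed
    also have "\<dots> = (\<Sum>l\<le>L. g l * x s ^ l) * x s ^ (n - 1 - j)"
      unfolding power_add sum_distrib_right by (intro sum.cong refl) (simp only: mult_ac)
    finally show ?case using s j by (simp add: V_def)
  qed (auto simp: W_def T_def V_def)
  have carrier: "W \<in> carrier_mat n n" "T g L \<in> carrier_mat n n" "V \<in> carrier_mat n n" for g L
    by (auto simp: W_def T_def V_def)
  have prod: "Determinant.det W * Determinant.det (T g L) = (\<Prod>s<n. \<Sum>l\<le>L. g l * x s ^ l) * Determinant.det V" for g L
  proof -
    have "Determinant.det (mat_diag n (\<lambda>s. \<Sum>l\<le>L. g l * x s ^ l)) = (\<Prod>s<n. \<Sum>l\<le>L. g l * x s ^ l)"
      by (subst det_upper_triangular[of _ n])
         (auto simp: mat_diag_def upper_triangular_def diag_mat_def prod.list_conv_set_nth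
           atLeast0LessThan intro!: prod.cong)
    then show ?thesis
      using arg_cong[OF row[of g L], of Determinant.det] carrier
      by (simp add: det_mult[where n = n])
  qed
  have F0: "fps_nth F 0 = 1"
    unfolding F_def by (simp add: fps_nth_prod_geometric_0)
  \<comment> \<open>The symbol with \<open>g = 1\<close> calibrates the identity: its matrix is
    unipotent, which forces \<open>W\<close> and \<open>V\<close> to have equal determinants without
    either being evaluated.\<close>
  have "Determinant.det (T (\<lambda>_. 1) 0) = 1"
    using toeplitz_det_unipotent[OF F0, of n] by (simp add: T_def toeplitz_det_def)
  then have "Determinant.det W = Determinant.det V"
    using prod[of "\<lambda>_. 1" 0] by simp
  moreover have "Determinant.det V \<noteq> 0"
    unfolding V_def by (rule det_vandermonde_neq_0[OF inj])
  ultimately show ?thesis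
    using prod[of g L] by (simp add: T_def toeplitz_det_def)
qed

section \<open>Distinct parts and alternating sums\<close>

text \<open>The finite q-Pochhammer symbol \<open>(t; t)_m\<close>.\<close>

definition q_fact :: "'a :: comm_ring_1 \<Rightarrow> nat \<Rightarrow> 'a" where
  "q_fact t m = (\<Prod>i<m. 1 - t ^ Suc i)"

lemma q_fact_0 [simp]: "q_fact t 0 = 1"
  and q_fact_Suc: "q_fact t (Suc m) = q_fact t m * (1 - t ^ Suc m)"
  by (simp_all add: q_fact_def)

definition max_part :: "nat multiset \<Rightarrow> nat" where
  "max_part p = Max (insert 0 (set_mset p))"

definition set_alternating_sum :: "nat set \<Rightarrow> int" where
  "set_alternating_sum U = alternating_sum (rev (sorted_list_of_set U))"

lemma alternating_sum_Cons: "alternating_sum (u # us) = int u - alternating_sum us"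
  by (simp add: alternating_sum_def sum.lessThan_Suc_shift sum_negf del: sum.lessThan_Suc)

lemma set_alternating_sum_empty [simp]: "set_alternating_sum {} = 0"
  by (simp add: set_alternating_sum_def alternating_sum_def)

lemma set_alternating_sum_insert_greater:
  assumes "finite U" "\<And>u. u \<in> U \<Longrightarrow> u < n"
  shows "set_alternating_sum (insert n U) = int n - set_alternating_sum U"
proof -
  have "sorted_list_of_set (insert n U) = sorted_list_of_set U @ [n]"
    using assms
    by (intro sorted_distinct_set_unique sorted_sorted_list_of_set distinct_sorted_list_of_set)
       (auto simp: sorted_append less_imp_le simp del: sorted_list_of_set_insert_remove)
  then show ?thesis by (simp add: set_alternating_sum_def alternating_sum_Cons)
qed

lemma subset_atLeastAtMost_Suc_cases:
  assumes "U \<subseteq> {1..Suc n}"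
  obtains "U \<subseteq> {1..n}" | V where "V \<subseteq> {1..n}" "U = insert (Suc n) V"
proof (cases "Suc n \<in> U")
  case True
  have "U - {Suc n} \<subseteq> {1..n}" using assms by (auto simp: le_Suc_eq)
  moreover have "U = insert (Suc n) (U - {Suc n})" using True by auto
  ultimately show thesis using that by blast
next
  case False
  then have "U \<subseteq> {1..n}" using assms by (force simp: le_Suc_eq)
  then show thesis using that by blast
qed

lemma set_alternating_sum_insert_Suc:
  assumes "V \<subseteq> {1..n}"
  shows "set_alternating_sum (insert (Suc n) V) = int (Suc n) - set_alternating_sum V"
  by (rule set_alternating_sum_insert_greater) (use assms in \<open>auto intro: finite_subset\<close>)

text \<open>Adding the new maximum \<open>Suc n\<close> reflects the alternating sum,
  \<open>s\<close> becoming \<open>Suc n - s\<close>, so lower and upper bounds exchange roles and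
  have to be proved together.\<close>

lemma set_alternating_sum_bounds:
  assumes "U \<subseteq> {1..n}"
  shows "0 \<le> set_alternating_sum U \<and> set_alternating_sum U \<le> int n
       \<and> set_alternating_sum U \<le> int (\<Sum>U)"
  using assms
proof (induction n arbitrary: U)
  case (Suc n)
  from Suc.prems show ?case
  proof (cases rule: subset_atLeastAtMost_Suc_cases)
    case 1 then show ?thesis using Suc.IH[of U] by auto
  next
    case (2 V)
    then have "finite V" "Suc n \<notin> V" by (auto intro: finite_subset)
    then show ?thesis
      using 2 Suc.IH[of V] by (simp add: set_alternating_sum_insert_Suc)
  qed
qed auto

text \<open>The index is an integer so that the reflection \<open>Suc n - l\<close> in the recursion
  needs no side condition.\<close>

definition distinct_poly :: "'a :: comm_ring_1 \<Rightarrow> nat \<Rightarrow> int \<Rightarrow> 'a" where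
  "distinct_poly q n l = (\<Sum>U | U \<subseteq> {1..n} \<and> set_alternating_sum U = l. q ^ \<Sum>U)"

lemma finite_subsets_alternating [simp]: "finite {U. U \<subseteq> {1..n::nat} \<and> P U}"
  by (rule finite_subset[of _ "Pow {1..n}"]) auto

lemma distinct_poly_0: "distinct_poly q 0 l = (if l = 0 then 1 else 0)"
proof -
  have "{U. U \<subseteq> {1..0::nat} \<and> set_alternating_sum U = l} = (if l = 0 then {{}} else {})" by auto
  then show ?thesis by (simp add: distinct_poly_def)
qed

lemma distinct_poly_eq_0:
  assumes "l < 0 \<or> l > int n"
  shows "distinct_poly q n l = 0"
proof -
  have "set_alternating_sum U \<noteq> l" if "U \<subseteq> {1..n}" for U
    using set_alternating_sum_bounds[OF that] assms by auto
  then have "{U. U \<subseteq> {1..n} \<and> set_alternating_sum U = l} = {}" by blast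
  then show ?thesis by (simp only: distinct_poly_def sum.empty)
qed

lemma distinct_poly_Suc:
  "distinct_poly q (Suc n) l = distinct_poly q n l + q ^ Suc n * distinct_poly q n (int (Suc n) - l)"
proof -
  let ?A = "\<lambda>n l. {U. U \<subseteq> {1..n} \<and> set_alternating_sum U = l}"
  have eq: "?A (Suc n) l = ?A n l \<union> insert (Suc n) ` ?A n (int (Suc n) - l)"
  proof (intro equalityI subsetI)
    fix U assume U: "U \<in> ?A (Suc n) l"
    then have "U \<subseteq> {1..Suc n}" by simp
    then show "U \<in> ?A n l \<union> insert (Suc n) ` ?A n (int (Suc n) - l)"
      using U by (cases rule: subset_atLeastAtMost_Suc_cases) (auto simp: set_alternating_sum_insert_Suc)
  next
    fix U assume "U \<in> ?A n l \<union> insert (Suc n) ` ?A n (int (Suc n) - l)"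
    then show "U \<in> ?A (Suc n) l"
      by (auto simp: set_alternating_sum_insert_Suc)
  qed
  have inj: "inj_on (insert (Suc n)) (?A n (int (Suc n) - l))"
  proof (rule inj_onI)
    fix U V assume "U \<in> ?A n (int (Suc n) - l)" "V \<in> ?A n (int (Suc n) - l)"
    then have "Suc n \<notin> U" "Suc n \<notin> V" by auto
    then show "insert (Suc n) U = insert (Suc n) V \<Longrightarrow> U = V"
      by (metis insert_ident)
  qed
  have "distinct_poly q (Suc n) l = distinct_poly q n l
      + (\<Sum>U\<in>insert (Suc n) ` ?A n (int (Suc n) - l). q ^ \<Sum>U)"
    unfolding distinct_poly_def eq by (rule sum.union_disjoint) auto
  also have "(\<Sum>U\<in>insert (Suc n) ` ?A n (int (Suc n) - l). q ^ \<Sum>U)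
      = (\<Sum>U\<in>?A n (int (Suc n) - l). q ^ Suc n * q ^ \<Sum>U)"
    unfolding sum.reindex[OF inj] o_def
  proof (rule sum.cong[OF refl])
    fix U assume "U \<in> ?A n (int (Suc n) - l)"
    then have "finite U" "Suc n \<notin> U" by (auto intro: finite_subset)
    then show "q ^ \<Sum>(insert (Suc n) U) = q ^ Suc n * q ^ \<Sum>U"
      by (simp add: power_add)
  qed
  finally show ?thesis by (simp only: distinct_poly_def sum_distrib_left)
qed

text \<open>The alternating sum of a subset of \<open>{1..n}\<close> is distributed like a Gaussian binomial coefficient:
  the recursion according to whether \<open>n\<close> occurs is the \<open>q\<close>-Pascal rule.\<close>

lemma distinct_poly_q_binomial:
  assumes "l \<le> n"
  shows "distinct_poly q n (int l) * q_fact (q\<^sup>2) l * q_fact (q\<^sup>2) (n - l) = q ^ l * q_fact (q\<^sup>2) n"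
  using assms
proof (induction n arbitrary: l)
  case 0 then show ?case by (simp add: distinct_poly_0)
next
  case (Suc n)
  consider "l = 0" | "l = Suc n" | k where "l = Suc k" "k < n"
    using Suc.prems by (cases l) force+
  then show ?case
  proof cases
    case 1
    have "distinct_poly q (Suc n) 0 = distinct_poly q n 0"
      by (simp add: distinct_poly_Suc distinct_poly_eq_0)
    then show ?thesis using 1 Suc.IH[of 0] by (simp add: q_fact_Suc mult.assoc[symmetric])
  next
    case 2
    have "distinct_poly q (Suc n) (int (Suc n)) = q ^ Suc n * distinct_poly q n 0"
      by (subst distinct_poly_Suc) (simp add: distinct_poly_eq_0)
    then have "distinct_poly q (Suc n) (int l) * q_fact (q\<^sup>2) l * q_fact (q\<^sup>2) (Suc n - l)
      = q ^ Suc n * (distinct_poly q n 0 * q_fact (q\<^sup>2) n) * (1 - (q\<^sup>2) ^ Suc n)"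
      using 2 by (simp add: q_fact_Suc mult.assoc del: power_Suc)
    also have "distinct_poly q n 0 * q_fact (q\<^sup>2) n = q_fact (q\<^sup>2) n"
      using Suc.IH[of 0] by simp
    finally show ?thesis using 2 by (simp only: q_fact_Suc mult.assoc)
  next
    case (3 k)
    define P where "P = q_fact (q\<^sup>2)"
    have n: "Suc n - l = Suc (n - l)" "n - (n - k) = k" using 3 by auto
    have IH1: "distinct_poly q n (int l) * P l * P (n - l) = q ^ l * P n"
      using 3 Suc.IH[of l] by (simp add: P_def)
    have IH2: "distinct_poly q n (int (n - k)) * P (n - k) * P k = q ^ (n - k) * P n"
      using 3 Suc.IH[of "n - k"] n by (simp add: P_def)
    \<comment> \<open>The subsets containing \<open>Suc n\<close> are counted at the reflected index
      \<open>n - k\<close>, whose complement is \<open>k = l - 1\<close>. Each induction hypothesis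
      thus lacks just one factor of the common product \<open>P l * P (Suc n - l)\<close>.\<close>
    have "int (Suc n) - int l = int (n - k)" "n - k = Suc (n - l)" using 3 by auto
    then have "distinct_poly q (Suc n) (int l) * P l * P (Suc n - l)
       = (distinct_poly q n (int l) * P l * P (n - l)) * (1 - (q\<^sup>2) ^ Suc (n - l))
         + q ^ Suc n * (distinct_poly q n (int (n - k)) * P (n - k) * P k) * (1 - (q\<^sup>2) ^ l)"
      unfolding distinct_poly_Suc[of q n "int l"] using 3 n by (simp add: P_def q_fact_Suc algebra_simps)
    also have "\<dots> = q ^ l * P n * (1 - (q\<^sup>2) ^ Suc (n - l)) + q ^ (Suc n + (n - k)) * P n * (1 - (q\<^sup>2) ^ l)"
      unfolding IH1 IH2 by (simp add: power_add mult.assoc)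
    \<comment> \<open>This exponent makes the two contributions combine by
      \<open>(1 - t ^ a) + t ^ a * (1 - t ^ l) = 1 - t ^ (a + l)\<close>, with \<open>t\<close> the
      square of \<open>q\<close> and \<open>a = Suc (n - l)\<close>.\<close>
    also have "Suc n + (n - k) = l + 2 * Suc (n - l)" using 3 by simp
    also have "q ^ l * P n * (1 - (q\<^sup>2) ^ Suc (n - l)) + q ^ (l + 2 * Suc (n - l)) * P n * (1 - (q\<^sup>2) ^ l)
       = q ^ l * P n * (1 - (q\<^sup>2) ^ (Suc (n - l) + l))"
      by (simp only: power_add power_mult[symmetric] algebra_simps mult_1_left mult_1_right)
    also have "Suc (n - l) + l = Suc n" using 3 by simp
    finally show ?thesis by (simp only: P_def q_fact_Suc mult.assoc)
  qed
qed


section \<open>Distinct parts without bound, and congruence modulo powers of the variable\<close>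

definition distinct_series :: "nat \<Rightarrow> 'a :: comm_ring_1 fps" where
  "distinct_series l = Abs_fps (\<lambda>n. of_nat
     (card {U. finite U \<and> 0 \<notin> U \<and> set_alternating_sum U = int l \<and> \<Sum>U = n}))"

lemma subset_of_sum:
  fixes U :: "nat set"
  assumes "finite U" "0 \<notin> U"
  shows "U \<subseteq> {1..\<Sum>U}"
proof
  fix u assume "u \<in> U"
  moreover from this have "u \<le> \<Sum>U" using assms by (intro member_le_sum) auto
  ultimately show "u \<in> {1..\<Sum>U}" using assms by (cases u) auto
qed

lemma fps_nth_distinct_series_eq:
  assumes "n \<le> N"
  shows "fps_nth (distinct_series l :: 'a :: comm_ring_1 fps) n = fps_nth (distinct_poly fps_X N (int l)) n"
proof -
  have "{U. finite U \<and> 0 \<notin> U \<and> set_alternating_sum U = int l \<and> \<Sum>U = n}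
      = {U \<in> {U. U \<subseteq> {1..N} \<and> set_alternating_sum U = int l}. \<Sum>U = n}" (is "?A = ?B")
  proof (intro equalityI subsetI)
    fix U assume U: "U \<in> ?A"
    then have "U \<subseteq> {1..\<Sum>U}" by (intro subset_of_sum) auto
    also have "\<dots> \<subseteq> {1..N}" using U assms by auto
    finally show "U \<in> ?B" using U by simp
  qed (auto intro: finite_subset)
  moreover have "fps_nth (distinct_poly fps_X N (int l) :: 'a fps) n = of_nat (card ?B)"
  proof -
    have "fps_nth (distinct_poly fps_X N (int l) :: 'a fps) n
        = (\<Sum>U | U \<subseteq> {1..N} \<and> set_alternating_sum U = int l. if \<Sum>U = n then 1 else 0)"
      unfolding distinct_poly_def fps_sum_nth by (intro sum.cong refl) (simp add: fps_X_power_nth)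
    also have "\<dots> = of_nat (card ?B)"
      by (subst sum.inter_filter[symmetric]) simp_all
    finally show ?thesis .
  qed
  ultimately show ?thesis by (simp add: distinct_series_def)
qed

text \<open>Congruence modulo \<open>fps_X ^ (N + 1)\<close>. It is compatible with sums, products
  and hence determinants, so the formal limits reduce to exact computations with finite
  truncations.\<close>

definition eq_upto :: "nat \<Rightarrow> 'a :: zero fps \<Rightarrow> 'a fps \<Rightarrow> bool" where
  "eq_upto N A B \<longleftrightarrow> (\<forall>n\<le>N. fps_nth A n = fps_nth B n)"

lemma eq_upto_refl [simp]: "eq_upto N A A"
  and eq_upto_sym: "eq_upto N A B \<Longrightarrow> eq_upto N B A"
  and eq_upto_trans [trans]: "eq_upto N A B \<Longrightarrow> eq_upto N B C \<Longrightarrow> eq_upto N A C"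
  by (simp_all add: eq_upto_def)

lemma eq_upto_mult:
  "eq_upto N A B \<Longrightarrow> eq_upto N C D \<Longrightarrow> eq_upto N (A * C) (B * D)"
  for A B C D :: "'a :: comm_ring_1 fps"
  by (auto simp: eq_upto_def fps_mult_nth intro!: sum.cong)

lemma eq_upto_sum:
  "(\<And>i. i \<in> S \<Longrightarrow> eq_upto N (f i) (g i)) \<Longrightarrow> eq_upto N (sum f S) (sum g S)"
  for f g :: "'b \<Rightarrow> 'a :: comm_ring_1 fps"
  by (auto simp: eq_upto_def fps_sum_nth intro!: sum.cong)

lemma eq_upto_prod:
  "(\<And>i. i \<in> S \<Longrightarrow> eq_upto N (f i) (g i)) \<Longrightarrow> eq_upto N (prod f S) (prod g S)"
  for f g :: "'b \<Rightarrow> 'a :: comm_ring_1 fps"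
  by (induction S rule: infinite_finite_induct) (auto intro!: eq_upto_mult)

lemma eq_upto_power: "eq_upto N A B \<Longrightarrow> eq_upto N (A ^ m) (B ^ m)"
  for A B :: "'a :: comm_ring_1 fps"
  by (induction m) (auto intro!: eq_upto_mult)

lemma eq_upto_X_power_mult:
  "N < m \<Longrightarrow> eq_upto N (fps_X ^ m * A) 0" for A :: "'a :: comm_ring_1 fps"
  by (simp add: eq_upto_def fps_X_power_mult_nth)

lemma eq_upto_diff:
  "eq_upto N A B \<Longrightarrow> eq_upto N C D \<Longrightarrow> eq_upto N (A - C) (B - D)"
  for A B C D :: "'a :: comm_ring_1 fps"
  by (simp add: eq_upto_def)

lemma eq_upto_q_fact:
  assumes "n \<le> m" "N < 2 * Suc n"
  shows "eq_upto N (q_fact (fps_X\<^sup>2) m :: 'a :: comm_ring_1 fps) (q_fact (fps_X\<^sup>2) n)"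
  using assms(1)
proof (induction m rule: dec_induct)
  case (step m)
  have "eq_upto N (fps_X ^ (2 * Suc m) * 1 :: 'a fps) 0"
    using assms(2) step.hyps by (intro eq_upto_X_power_mult) simp
  then have "eq_upto N (1 - (fps_X\<^sup>2) ^ Suc m) (1 - 0 :: 'a fps)"
    by (intro eq_upto_diff) (simp_all only: mult_1_right power_mult eq_upto_refl)
  then have "eq_upto N (q_fact (fps_X\<^sup>2) m * (1 - (fps_X\<^sup>2) ^ Suc m)) (q_fact (fps_X\<^sup>2) n * (1 - 0 :: 'a fps))"
    by (intro eq_upto_mult step.IH)
  then show ?case by (simp only: q_fact_Suc diff_zero mult_1_right)
qed simp

lemma fps_nth_q_fact_0: "fps_nth (q_fact (fps_X\<^sup>2) n :: 'a :: comm_ring_1 fps) 0 = 1"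
  by (induction n) (simp_all add: q_fact_Suc)

text \<open>The limit of the Gaussian binomials. For the coefficient of degree \<open>n\<close> the
  parts may be bounded by \<open>n + l\<close>; then the complementary factor is \<open>P n\<close>,
  and it cancels against \<open>P (n + l)\<close> because the additional factors are 1 up to degree
  \<open>n\<close>.\<close>

lemma distinct_series_times_q_fact:
  "distinct_series l * q_fact (fps_X\<^sup>2) l = (fps_X ^ l :: 'a :: field fps)"
proof (rule fps_ext)
  fix n
  define P where "P = (q_fact (fps_X\<^sup>2) :: nat \<Rightarrow> 'a fps)"
  have P: "P n * inverse (P n) = 1"
    by (intro inverse_mult_eq_1') (simp add: P_def fps_nth_q_fact_0)
  have "eq_upto n (distinct_series l * P l) (distinct_poly fps_X (n + l) (int l) * P l)"
    by (intro eq_upto_mult) (simp_all add: eq_upto_def fps_nth_distinct_series_eq[of _ "n + l"])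
  also have "distinct_poly fps_X (n + l) (int l) * P l
      = (distinct_poly fps_X (n + l) (int l) * P l * P (n + l - l)) * inverse (P n)"
    using P by (simp add: mult.assoc)
  also have "\<dots> = fps_X ^ l * P (n + l) * inverse (P n)"
    unfolding P_def by (subst distinct_poly_q_binomial) simp_all
  also have "eq_upto n \<dots> (fps_X ^ l * P n * inverse (P n))"
    unfolding P_def by (intro eq_upto_mult eq_upto_q_fact eq_upto_refl) simp_all
  also have "\<dots> = fps_X ^ l" using P by (simp add: mult.assoc)
  finally show "fps_nth (distinct_series l * q_fact (fps_X\<^sup>2) l) n = fps_nth (fps_X ^ l :: 'a fps) n"
    by (simp add: eq_upto_def P_def)
qed

section \<open>Decomposition of partitions\<close>

text \<open>Sizes are doubled because the partition enters in two copies. The index is an integer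
  because it will be \<open>m + int l\<close>, which may be negative.\<close>

definition max_part_series :: "int \<Rightarrow> 'a :: comm_ring_1 fps" where
  "max_part_series k = Abs_fps (\<lambda>n. of_nat
     (card {p. 0 \<notin># p \<and> int (max_part p) = k \<and> 2 * sum_mset p = n}))"

definition bounded_part_series :: "nat \<Rightarrow> 'a :: comm_ring_1 fps" where
  "bounded_part_series k = Abs_fps (\<lambda>n. of_nat
     (card {p. set_mset p \<subseteq> {1..k} \<and> 2 * sum_mset p = n}))"

definition rank_series :: "int \<Rightarrow> 'a :: comm_ring_1 fps" where
  "rank_series m = Abs_fps (\<lambda>n. of_nat (card {p \<in> partitions_of_rank m. sum_mset p = n}))"

text \<open>Otherwise the simplifier moves the factor 2 of \<open>2 * sum_mset p\<close> into the multiset.\<close>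

declare mult_hom.hom_sum_mset [simp del]

lemma size_le_sum_mset: "0 \<notin># p \<Longrightarrow> size p \<le> sum_mset p" for p :: "nat multiset"
  by (induction p) auto

lemma finite_partitions: "finite {p :: nat multiset. 0 \<notin># p \<and> sum_mset p = n}"
proof (rule finite_subset)
  show "finite (mset ` {xs. set xs \<subseteq> {..n} \<and> length xs \<le> n})"
    by (intro finite_imageI finite_lists_length_le) simp
  show "{p :: nat multiset. 0 \<notin># p \<and> sum_mset p = n} \<subseteq> mset ` {xs. set xs \<subseteq> {..n} \<and> length xs \<le> n}"
  proof
    fix p :: "nat multiset" assume p: "p \<in> {p. 0 \<notin># p \<and> sum_mset p = n}"
    obtain xs where xs: "mset xs = p" using ex_mset by blast
    have "set xs \<subseteq> {..n}"
    proof
      fix i assume "i \<in> set xs"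
      then obtain q where "p = add_mset i q" using xs by (metis multi_member_split set_mset_mset)
      then show "i \<in> {..n}" using p by auto
    qed
    moreover have "length xs \<le> n"
      using p xs size_le_sum_mset[of p] by auto
    ultimately show "p \<in> mset ` {xs. set xs \<subseteq> {..n} \<and> length xs \<le> n}" using xs by blast
  qed
qed

lemma finite_double_partitions:
  assumes "\<And>p. P p \<Longrightarrow> 0 \<notin># p"
  shows "finite {p :: nat multiset. P p \<and> 2 * sum_mset p = n}"
  by (rule finite_subset[OF _ finite_partitions[of "n div 2"]]) (use assms in auto)

lemma card_add_mset_part:
  "card (add_mset k ` {p :: nat multiset. P p \<and> 2 * sum_mset p + 2 * k = n}) =
     (if n < 2 * k then 0 else card {p. P p \<and> 2 * sum_mset p = n - 2 * k})"
proof -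
  have "{p :: nat multiset. P p \<and> 2 * sum_mset p + 2 * k = n}
      = (if n < 2 * k then {} else {p. P p \<and> 2 * sum_mset p = n - 2 * k})" by auto
  then show ?thesis by (auto intro!: card_image inj_onI)
qed

text \<open>Either \<open>Suc k\<close> does not occur, or removing one copy of it leaves an
  arbitrary partition with the same bound.\<close>

lemma bounded_part_series_Suc:
  "bounded_part_series (Suc k)
     = bounded_part_series k + fps_X ^ (2 * Suc k) * (bounded_part_series (Suc k) :: 'a :: comm_ring_1 fps)"
proof (rule fps_ext)
  fix n :: nat
  let ?A = "\<lambda>k. {p. set_mset p \<subseteq> {1..k} \<and> 2 * sum_mset p = n}"
  let ?B = "add_mset (Suc k) ` {p. set_mset p \<subseteq> {1..Suc k} \<and> 2 * sum_mset p + 2 * Suc k = n}"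
  have eq: "?A (Suc k) = ?A k \<union> ?B"
  proof (intro equalityI subsetI)
    fix p assume p: "p \<in> ?A (Suc k)"
    show "p \<in> ?A k \<union> ?B"
    proof (cases "Suc k \<in># p")
      case True
      then obtain q where "p = add_mset (Suc k) q" by (meson multi_member_split)
      then show ?thesis using p by auto
    next
      case False
      have "set_mset p \<subseteq> {1..k}"
      proof
        fix i assume i: "i \<in># p"
        then have "i \<noteq> Suc k" using False by blast
        moreover have "i \<in> {1..Suc k}" using i p by blast
        ultimately show "i \<in> {1..k}" by auto
      qed
      then show ?thesis using p by auto
    qed
  qed fastforce+
  have "?A k \<inter> ?B = {}" by fastforce
  moreover have fin: "finite (?A j)" for j by (intro finite_double_partitions) auto
  moreover have "finite ?B"
    by (rule finite_subset[OF _ fin[of "Suc k"]]) (subst eq, simp)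
  ultimately have "card (?A (Suc k)) = card (?A k) + card ?B"
    unfolding eq by (intro card_Un_disjoint)
  then show "fps_nth (bounded_part_series (Suc k)) n
      = fps_nth (bounded_part_series k + fps_X ^ (2 * Suc k) * (bounded_part_series (Suc k) :: 'a fps)) n"
    by (simp add: bounded_part_series_def fps_X_power_mult_nth card_add_mset_part del: mult_Suc_right)
qed

lemma bounded_part_series_times_q_fact:
  "bounded_part_series k * q_fact (fps_X\<^sup>2) k = (1 :: 'a :: comm_ring_1 fps)"
proof (induction k)
  case 0
  have "{p :: nat multiset. set_mset p \<subseteq> {1..0} \<and> 2 * sum_mset p = n} = (if n = 0 then {{#}} else {})" for n
    by auto
  then show ?case by (auto simp: bounded_part_series_def fps_eq_iff)
next
  case (Suc k)
  have "bounded_part_series (Suc k) * (1 - fps_X ^ (2 * Suc k)) = (bounded_part_series k :: 'a fps)"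
    using bounded_part_series_Suc[of k, where 'a = 'a] by (simp add: algebra_simps)
  then have "bounded_part_series (Suc k) * (1 - (fps_X\<^sup>2) ^ Suc k) * q_fact (fps_X\<^sup>2) k = (1 :: 'a fps)"
    using Suc.IH by (simp only: power_mult)
  then show ?case by (simp only: q_fact_Suc mult_ac)
qed

lemma max_part_eq_iff:
  "0 < k \<Longrightarrow> max_part p = k \<longleftrightarrow> k \<in># p \<and> set_mset p \<subseteq> {..k}"
  unfolding max_part_def by (subst Max_eq_iff) auto

text \<open>Removing one copy of the largest part \<open>k\<close> costs \<open>2 * k\<close> in
  doubled size and leaves any partition with parts at most \<open>k\<close>. For
  \<open>k = 0\<close> nothing can be removed, and both sides count the empty partition
  only.\<close>

lemma max_part_series_eq:
  "max_part_series (int k) = fps_X ^ (2 * k) * (bounded_part_series k :: 'a :: comm_ring_1 fps)"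
proof (rule fps_ext)
  fix n :: nat
  have "{p. 0 \<notin># p \<and> int (max_part p) = int k \<and> 2 * sum_mset p = n}
      = add_mset k ` {p. set_mset p \<subseteq> {1..k} \<and> 2 * sum_mset p + 2 * k = n}" (is "?A = ?B")
    if "0 < k"
  proof (intro equalityI subsetI)
    fix p assume p: "p \<in> ?A"
    then have k: "k \<in># p" "set_mset p \<subseteq> {..k}" using that by (auto simp: max_part_eq_iff)
    then obtain q where q: "p = add_mset k q" by (meson multi_member_split)
    have "set_mset q \<subseteq> {1..k}"
    proof
      fix i assume "i \<in># q"
      then have "i \<noteq> 0" "i \<in> {..k}" using p k(2) q by (auto intro: gr0I)
      then show "i \<in> {1..k}" by auto
    qed
    then show "p \<in> ?B" using p q by auto
  qed (use that in \<open>fastforce simp: max_part_eq_iff\<close>)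
  moreover have "{p. 0 \<notin># p \<and> int (max_part p) = int 0 \<and> 2 * sum_mset p = n}
      = {p. set_mset p \<subseteq> {1..0} \<and> 2 * sum_mset p = n}"
  proof -
    have "0 \<notin># p \<and> max_part p = 0 \<longleftrightarrow> set_mset p \<subseteq> {1..0}" for p
      by (cases p) (auto simp: max_part_def Max_eq_iff)
    then show ?thesis by auto
  qed
  ultimately show "fps_nth (max_part_series (int k)) n
      = fps_nth (fps_X ^ (2 * k) * (bounded_part_series k :: 'a fps)) n"
    by (cases "k = 0")
       (simp_all add: max_part_series_def bounded_part_series_def fps_X_power_mult_nth card_add_mset_part)
qed

lemma max_part_series_times_q_fact:
  "max_part_series (int k) * q_fact (fps_X\<^sup>2) k = (fps_X ^ (2 * k) :: 'a :: comm_ring_1 fps)"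
  by (simp add: max_part_series_eq bounded_part_series_times_q_fact mult.assoc)

lemma max_part_series_neg: "k < 0 \<Longrightarrow> max_part_series k = 0"
  by (simp add: max_part_series_def fps_eq_iff)

section \<open>The bijection between partitions and pairs\<close>

definition half_multiset :: "nat multiset \<Rightarrow> nat multiset" where
  "half_multiset p = (\<Sum>i\<in>set_mset p. replicate_mset (count p i div 2) i)"

lemma count_half_multiset [simp]: "count (half_multiset p) i = count p i div 2"
  by (simp add: half_multiset_def count_sum count_replicate_mset sum.delta not_in_iff if_distrib cong: if_cong)

definition odd_set :: "nat multiset \<Rightarrow> nat set" where
  "odd_set p = {i \<in> set_mset p. odd (count p i)}"

definition pair_join :: "nat multiset \<times> nat set \<Rightarrow> nat multiset" where
  "pair_join = (\<lambda>(p, U). p + p + mset_set U)"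

lemma pair_join_half_odd: "pair_join (half_multiset p, odd_set p) = p"
proof (rule multiset_eqI)
  fix i
  have "finite (odd_set p)" by (simp add: odd_set_def)
  then have "count (mset_set (odd_set p)) i = (if odd (count p i) then 1 else 0)"
    by (cases "i \<in># p") (auto simp: odd_set_def count_mset_set' not_in_iff)
  then show "count (pair_join (half_multiset p, odd_set p)) i = count p i"
    by (auto simp: pair_join_def) presburger+
qed

context
  fixes p :: "nat multiset" and U :: "nat set"
  assumes U: "finite U"
begin

lemma half_pair_join: "half_multiset (pair_join (p, U)) = p"
  using U by (intro multiset_eqI) (auto simp: pair_join_def count_mset_set')

lemma odd_pair_join: "odd_set (pair_join (p, U)) = U"
  using U by (auto simp: pair_join_def odd_set_def count_mset_set' split: if_splits)

lemma sum_pair_join: "sum_mset (pair_join (p, U)) = 2 * sum_mset p + \<Sum>U"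
  by (simp add: pair_join_def sum_unfold_sum_mset)

lemma is_partition_pair_join: "is_partition (pair_join (p, U)) \<longleftrightarrow> 0 \<notin># p \<and> 0 \<notin> U"
  using U by (simp add: pair_join_def is_partition_def)

text \<open>As \<open>U\<close> supplies at most one copy of each part, a part is repeated exactly
  when it occurs in \<open>p\<close>; the parity of a multiplicity, on the other hand, depends on
  \<open>U\<close> alone. The two terms of the rank therefore separate.\<close>

lemma pairing_rank_pair_join:
  "pairing_rank (pair_join (p, U)) = int (max_part p) - set_alternating_sum U"
proof -
  have "{i \<in> set_mset (pair_join (p, U)). 2 \<le> count (pair_join (p, U)) i} = set_mset p"
  proof (intro equalityI subsetI)
    fix i assume "i \<in> {i \<in> set_mset (pair_join (p, U)). 2 \<le> count (pair_join (p, U)) i}"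
    then show "i \<in># p"
      using U by (auto simp: pair_join_def count_mset_set' not_in_iff split: if_splits intro: ccontr)
  next
    fix i assume i: "i \<in># p"
    then obtain c where "count p i = Suc c" by (metis count_eq_zero_iff not0_implies_Suc)
    then show "i \<in> {i \<in> set_mset (pair_join (p, U)). 2 \<le> count (pair_join (p, U)) i}"
      using i U by (auto simp: pair_join_def count_mset_set')
  qed
  moreover have "odd_mult_parts (pair_join (p, U)) = rev (sorted_list_of_set U)"
    using odd_pair_join by (simp add: odd_mult_parts_def odd_set_def)
  ultimately show ?thesis
    by (simp add: pairing_rank_def largest_repeated_part_def max_part_def set_alternating_sum_def)
qed

end

text \<open>The pairs are sorted by the alternating sum \<open>l\<close> of the odd part and the
  size \<open>i\<close> of the doubled part. Restricting to \<open>l \<le> n\<close> loses nothing,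
  since an alternating sum lies between 0 and the sum of its parts.\<close>

lemma card_partitions_of_rank:
  "card {p \<in> partitions_of_rank m. sum_mset p = n} =
     (\<Sum>l\<le>n. \<Sum>i\<le>n. card {p. 0 \<notin># p \<and> int (max_part p) = m + int l \<and> 2 * sum_mset p = i} *
        card {U. finite U \<and> 0 \<notin> U \<and> set_alternating_sum U = int l \<and> \<Sum>U = n - i})"
proof -
  define A where "A l i = {p. 0 \<notin># p \<and> int (max_part p) = m + int l \<and> 2 * sum_mset p = i}" for l i
  define B where "B l i = {U. finite U \<and> 0 \<notin> U \<and> set_alternating_sum U = int l \<and> \<Sum>U = n - i}" for l i
  let ?T = "SIGMA l:{..n}. SIGMA i:{..n}. A l i \<times> B l i"
  have finA: "finite (A l i)" for l i
    unfolding A_def by (rule finite_subset[OF _ finite_partitions[of "i div 2"]]) auto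
  have finB: "finite (B l i)" for l i
  proof (rule finite_subset[of _ "Pow {1..n - i}"])
    show "B l i \<subseteq> Pow {1..n - i}"
    proof
      fix U assume "U \<in> B l i"
      then have "finite U" "0 \<notin> U" "\<Sum>U = n - i" by (auto simp: B_def)
      then show "U \<in> Pow {1..n - i}" using subset_of_sum[of U] by simp
    qed
  qed simp
  have "bij_betw (\<lambda>p. (nat (set_alternating_sum (odd_set p)), 2 * sum_mset (half_multiset p),
      half_multiset p, odd_set p)) {p \<in> partitions_of_rank m. sum_mset p = n} ?T"
  proof (rule bij_betw_byWitness[where f' = "\<lambda>(l, i, x). pair_join x"])
    show "(\<lambda>p. (nat (set_alternating_sum (odd_set p)), 2 * sum_mset (half_multiset p),
      half_multiset p, odd_set p)) ` {p \<in> partitions_of_rank m. sum_mset p = n} \<subseteq> ?T"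
    proof (rule image_subsetI)
      fix p assume p: "p \<in> {p \<in> partitions_of_rank m. sum_mset p = n}"
      have fin: "finite (odd_set p)" by (simp add: odd_set_def)
      have *: "is_partition (pair_join (half_multiset p, odd_set p))"
        "pairing_rank (pair_join (half_multiset p, odd_set p)) = m"
        "sum_mset (pair_join (half_multiset p, odd_set p)) = n"
        using p by (simp_all add: pair_join_half_odd partitions_of_rank_def)
      then have 1: "0 \<notin># half_multiset p" "0 \<notin> odd_set p"
        and 2: "int (max_part (half_multiset p)) - set_alternating_sum (odd_set p) = m"
        and 3: "2 * sum_mset (half_multiset p) + \<Sum>(odd_set p) = n"
        by (simp_all add: is_partition_pair_join[OF fin] pairing_rank_pair_join[OF fin] sum_pair_join[OF fin])
      have "0 \<le> set_alternating_sum (odd_set p)" "set_alternating_sum (odd_set p) \<le> int (\<Sum>(odd_set p))"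
        using set_alternating_sum_bounds[OF subset_of_sum[OF fin 1(2)]] by auto
      moreover have "\<Sum>(odd_set p) \<le> n" using 3 by simp
      ultimately have "nat (set_alternating_sum (odd_set p)) \<le> n" by linarith
      then show "(nat (set_alternating_sum (odd_set p)), 2 * sum_mset (half_multiset p),
          half_multiset p, odd_set p) \<in> ?T"
        using \<open>0 \<le> set_alternating_sum (odd_set p)\<close> 1 2 3 fin by (auto simp: A_def B_def)
    qed
    show "(\<lambda>(l, i, x). pair_join x) ` ?T \<subseteq> {p \<in> partitions_of_rank m. sum_mset p = n}"
      by (auto simp: A_def B_def partitions_of_rank_def is_partition_pair_join
          pairing_rank_pair_join sum_pair_join)
    show "\<forall>p\<in>{p \<in> partitions_of_rank m. sum_mset p = n}.
        (\<lambda>(l, i, x). pair_join x) (nat (set_alternating_sum (odd_set p)),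
          2 * sum_mset (half_multiset p), half_multiset p, odd_set p) = p"
      by (simp add: pair_join_half_odd)
    show "\<forall>t\<in>?T. (nat (set_alternating_sum (odd_set ((\<lambda>(l, i, x). pair_join x) t))),
        2 * sum_mset (half_multiset ((\<lambda>(l, i, x). pair_join x) t)),
        half_multiset ((\<lambda>(l, i, x). pair_join x) t), odd_set ((\<lambda>(l, i, x). pair_join x) t)) = t"
      by (auto simp: A_def B_def half_pair_join odd_pair_join)
  qed
  then have "card {p \<in> partitions_of_rank m. sum_mset p = n} = card ?T"
    by (rule bij_betw_same_card)
  also have "\<dots> = (\<Sum>l\<le>n. \<Sum>i\<le>n. card (A l i) * card (B l i))"
    by (simp add: card_SigmaI card_cartesian_product finA finB finite_SigmaI)
  finally show ?thesis unfolding A_def B_def .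
qed

text \<open>The factorisation \<open>f z * g (1 / z)\<close> read off at \<open>z ^ m\<close>. In a
  fixed degree in \<open>q\<close> the sum over \<open>l\<close> is finite, so no convergence
  question arises.\<close>

lemma fps_nth_rank_series:
  "fps_nth (rank_series m :: 'a :: comm_ring_1 fps) n
     = (\<Sum>l\<le>n. fps_nth (max_part_series (m + int l) * distinct_series l) n)"
  by (simp add: rank_series_def card_partitions_of_rank fps_mult_nth max_part_series_def
      distinct_series_def atLeast0AtMost)

section \<open>The formal limit\<close>

text \<open>The substitution of \<open>c * z\<close> for the variable \<open>z\<close>.\<close>

definition fps_scale :: "'a :: comm_ring_1 \<Rightarrow> 'a fps \<Rightarrow> 'a fps" where
  "fps_scale c A = Abs_fps (\<lambda>m. c ^ m * fps_nth A m)"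

lemma fps_nth_scale [simp]: "fps_nth (fps_scale c A) m = c ^ m * fps_nth A m"
  by (simp add: fps_scale_def)

text \<open>The recursion on the coefficients says \<open>(1 - x z) A(z) = A(t z)\<close>.\<close>

lemma eq_prod_geometric_times_scale:
  fixes A :: "'a :: comm_ring_1 fps"
  assumes rec: "\<And>m. fps_nth A (Suc m) * (1 - t ^ Suc m) = x * fps_nth A m"
  shows "A = (\<Prod>s<n. geometric_fps (x * t ^ s)) * fps_scale (t ^ n) A"
proof (induction n)
  case 0 show ?case by (simp add: fps_eq_iff)
next
  case (Suc n)
  have "(1 - fps_const (x * t ^ n) * fps_X) * fps_scale (t ^ n) A = fps_scale (t ^ Suc n) A"
  proof (rule fps_ext)
    fix m
    show "fps_nth ((1 - fps_const (x * t ^ n) * fps_X) * fps_scale (t ^ n) A) m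
        = fps_nth (fps_scale (t ^ Suc n) A) m"
    proof (cases m)
      case (Suc j)
      have "fps_nth ((1 - fps_const (x * t ^ n) * fps_X) * fps_scale (t ^ n) A) m
          = (t ^ n) ^ Suc j * fps_nth A (Suc j) - (t ^ n) ^ Suc j * (x * fps_nth A j)"
        using Suc by (simp add: left_diff_distrib mult.assoc mult.left_commute)
      also have "\<dots> = (t ^ Suc n) ^ Suc j * fps_nth A (Suc j)"
        unfolding rec[symmetric] by (simp add: algebra_simps power_mult_distrib)
      finally show ?thesis using Suc by simp
    qed (simp add: left_diff_distrib)
  qed
  then have "geometric_fps (x * t ^ n) * fps_scale (t ^ Suc n) A
      = geometric_fps (x * t ^ n) * ((1 - fps_const (x * t ^ n) * fps_X) * fps_scale (t ^ n) A)"
    by (simp only:)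
  also have "\<dots> = ((1 - fps_const (x * t ^ n) * fps_X) * geometric_fps (x * t ^ n)) * fps_scale (t ^ n) A"
    by (simp only: mult_ac)
  finally have "geometric_fps (x * t ^ n) * fps_scale (t ^ Suc n) A = \<dots>" .
  then have "fps_scale (t ^ n) A = geometric_fps (x * t ^ n) * fps_scale (t ^ Suc n) A"
    by (simp only: linear_times_geometric_fps mult_1_left)
  then show ?case using Suc.IH by (simp add: mult.assoc)
qed

text \<open>The functional equation of \<open>g\<close> for partial sums, where telescoping leaves
  one boundary term. Keeping that term exact serves both settings: it has high order in
  \<open>fps_X\<close> in the formal one and tends to 0 in the analytic one.\<close>

lemma truncated_functional_equation:
  fixes g :: "nat \<Rightarrow> 'a :: comm_ring_1"
  assumes rec: "\<And>m. g (Suc m) * (1 - t ^ Suc m) = y * g m"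
  shows "(1 - y * x) * (\<Sum>l\<le>L. g l * x ^ l)
      = (\<Sum>l\<le>L. g l * (t * x) ^ l) - y * x ^ Suc L * g L"
proof (induction L)
  case (Suc L)
  have "(1 - y * x) * (\<Sum>l\<le>Suc L. g l * x ^ l)
      = (\<Sum>l\<le>L. g l * (t * x) ^ l) - x ^ Suc L * (y * g L) + (1 - y * x) * (g (Suc L) * x ^ Suc L)"
    using Suc.IH by (simp add: algebra_simps)
  also have "\<dots> = (\<Sum>l\<le>Suc L. g l * (t * x) ^ l) - y * x ^ Suc (Suc L) * g (Suc L)"
    unfolding rec[symmetric] by (simp add: algebra_simps power_mult_distrib)
  finally show ?case .
qed (simp add: algebra_simps)

lemma series_rec_of_q_fact:
  fixes A :: "nat \<Rightarrow> 'a :: idom"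
  assumes "\<And>m. A m * q_fact t m = x ^ m" "q_fact t m \<noteq> 0"
  shows "A (Suc m) * (1 - t ^ Suc m) = x * A m"
proof -
  have "(A (Suc m) * (1 - t ^ Suc m)) * q_fact t m = (x * A m) * q_fact t m"
    using assms(1)[of m] assms(1)[of "Suc m"] by (simp add: q_fact_Suc mult_ac)
  then show ?thesis using assms(2) by simp
qed

lemma q_fact_X_neq_0: "q_fact (fps_X\<^sup>2) m \<noteq> (0 :: 'a :: field fps)"
  using fps_nth_q_fact_0[of m, where 'a = 'a] by auto

lemma max_part_series_rec:
  "max_part_series (int (Suc m)) * (1 - (fps_X\<^sup>2) ^ Suc m) = fps_X\<^sup>2 * (max_part_series (int m) :: 'a :: field fps)"
  by (rule series_rec_of_q_fact[where A = "\<lambda>m. max_part_series (int m)"])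
     (simp_all only: max_part_series_times_q_fact power_mult q_fact_X_neq_0 not_False_eq_True)

lemma distinct_series_rec:
  "distinct_series (Suc m) * (1 - (fps_X\<^sup>2) ^ Suc m) = fps_X * (distinct_series m :: 'a :: field fps)"
  by (rule series_rec_of_q_fact) (simp_all only: distinct_series_times_q_fact q_fact_X_neq_0 not_False_eq_True)

text \<open>Exhibits the factor \<open>fps_X ^ l\<close>, which bounds the range of \<open>l\<close>
  in every fixed degree; the remaining factor is later evaluated at complex numbers.\<close>

lemma distinct_series_eq_bounded:
  "distinct_series l = fps_X ^ l * (bounded_part_series l :: 'a :: field fps)"
  unfolding distinct_series_times_q_fact[of l, where 'a = 'a, symmetric]
  using bounded_part_series_times_q_fact[of l, where 'a = 'a] by (simp add: mult.assoc mult.commute)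

lemma eq_upto_rank_series:
  assumes "N \<le> L"
  shows "eq_upto N (rank_series m :: 'a :: field fps)
     (\<Sum>l\<le>L. max_part_series (m + int l) * distinct_series l)"
  unfolding eq_upto_def
proof (intro allI impI)
  fix n assume "n \<le> N"
  have "fps_nth (max_part_series (m + int l) * distinct_series l :: 'a fps) n = 0" if "n < l" for l
    using eq_upto_X_power_mult[OF that, of "max_part_series (m + int l) * bounded_part_series l :: 'a fps"]
    by (simp add: eq_upto_def distinct_series_eq_bounded mult.left_commute)
  then have "(\<Sum>l\<le>n. fps_nth (max_part_series (m + int l) * distinct_series l :: 'a fps) n)
      = (\<Sum>l\<le>L. fps_nth (max_part_series (m + int l) * distinct_series l) n)"
    using \<open>n \<le> N\<close> assms by (intro sum.mono_neutral_left) auto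
  then show "fps_nth (rank_series m :: 'a fps) n
      = fps_nth (\<Sum>l\<le>L. max_part_series (m + int l) * distinct_series l) n"
    by (simp only: fps_nth_rank_series fps_sum_nth)
qed

text \<open>Dropping all but the first \<open>k\<close> factors of \<open>f\<close> removes the tail
  \<open>f (t ^ k * z)\<close>. Its coefficients beyond the constant one are divisible by
  \<open>fps_X ^ (2 * k)\<close>, which is invisible up to degree \<open>N\<close>.\<close>

lemma eq_upto_max_part_series:
  assumes "N < 2 * k"
  shows "eq_upto N (max_part_series m :: 'a :: field fps)
     (int_coeff (\<Prod>s<k. geometric_fps ((fps_X\<^sup>2) ^ Suc s)) m)"
proof (cases "m < 0")
  case False
  define j where "j = nat m"
  define A :: "'a fps fps" where "A = Abs_fps (\<lambda>m. max_part_series (int m))"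
  define F :: "'a fps fps" where "F = (\<Prod>s<k. geometric_fps ((fps_X\<^sup>2) ^ Suc s))"
  have "A = F * fps_scale ((fps_X\<^sup>2) ^ k) A"
    unfolding F_def power_Suc by (rule eq_prod_geometric_times_scale) (simp only: A_def fps_nth_Abs_fps max_part_series_rec)
  then have "fps_nth A j = fps_nth (F * fps_scale ((fps_X\<^sup>2) ^ k) A) j" by (rule arg_cong)
  then have "max_part_series m = (\<Sum>i\<le>j. fps_nth F i * (((fps_X\<^sup>2) ^ k) ^ (j - i) * max_part_series (int (j - i))))"
    using False by (simp add: fps_mult_nth A_def j_def atLeast0AtMost)
  also have "eq_upto N \<dots> (\<Sum>i\<le>j. fps_nth F i * (if i = j then 1 else 0))"
  proof (intro eq_upto_sum eq_upto_mult eq_upto_refl)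
    fix i assume "i \<in> {..j}"
    show "eq_upto N (((fps_X\<^sup>2) ^ k) ^ (j - i) * max_part_series (int (j - i))) (if i = j then 1 else 0 :: 'a fps)"
    proof (cases "i = j")
      case False
      then have "j - i \<noteq> 0" using \<open>i \<in> {..j}\<close> by simp
      then have "N < 2 * k * (j - i)" using assms by (cases "j - i") auto
      then have "eq_upto N (fps_X ^ (2 * k * (j - i)) * max_part_series (int (j - i))) (0 :: 'a fps)"
        by (rule eq_upto_X_power_mult)
      then show ?thesis using False by (simp only: power_mult if_False)
    next
      case True
      have "max_part_series 0 = (1 :: 'a fps)"
        using max_part_series_times_q_fact[of 0, where 'a = 'a] by simp
      then show ?thesis using True by simp
    qed
  qed
  also have "\<dots> = int_coeff F m" using False by (simp add: int_coeff_def j_def mult_delta_right)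
  finally show ?thesis by (simp only: F_def)
qed (simp add: max_part_series_neg int_coeff_def)

lemma eq_upto_toeplitz_det:
  fixes a b :: "int \<Rightarrow> 'a :: comm_ring_1 fps"
  assumes "\<And>m. eq_upto N (a m) (b m)"
  shows "eq_upto N (toeplitz_det k a) (toeplitz_det k b)"
  unfolding toeplitz_det_def
  by (subst (1 2) det_def'[of _ k], simp, simp)
     (intro eq_upto_sum eq_upto_mult eq_upto_refl eq_upto_prod, auto simp: assms)

text \<open>The accumulated power \<open>h k ^ k\<close> takes up the new factor \<open>h k\<close>,
  and the \<open>Suc k\<close> copies of \<open>1 - c k\<close> then advance all of them to
  \<open>h (Suc k)\<close> at once.\<close>

lemma telescoping_product_upto:
  fixes h :: "nat \<Rightarrow> 'a :: comm_ring_1 fps"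
  assumes "\<And>s. eq_upto N ((1 - c s) * h s) (h (Suc s))"
  shows "eq_upto N ((\<Prod>s<k. h s) * (\<Prod>s<k. (1 - c s) ^ Suc s)) (h k ^ k)"
proof (induction k)
  case (Suc k)
  have "(\<Prod>s<Suc k. h s) * (\<Prod>s<Suc k. (1 - c s) ^ Suc s)
      = ((\<Prod>s<k. h s) * (\<Prod>s<k. (1 - c s) ^ Suc s)) * (h k * (1 - c k) ^ Suc k)"
    by (simp add: mult_ac)
  also have "eq_upto N \<dots> (h k ^ k * (h k * (1 - c k) ^ Suc k))"
    by (intro eq_upto_mult Suc.IH eq_upto_refl)
  also have "h k ^ k * (h k * (1 - c k) ^ Suc k) = ((1 - c k) * h k) ^ Suc k"
    by (simp add: power_mult_distrib mult_ac)
  also have "eq_upto N \<dots> (h (Suc k) ^ Suc k)"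
    by (intro eq_upto_power assms)
  finally show ?case .
qed simp

lemma eq_upto_prod_distinct_series:
  assumes "N < 2 * k"
  shows "eq_upto N ((\<Prod>s<k. \<Sum>l\<le>N. distinct_series l * ((fps_X\<^sup>2) ^ Suc s) ^ l)
     * (\<Prod>s<k. (1 - fps_X ^ (2 * (s + 1) + 1)) ^ Suc s)) (1 :: 'a :: field fps)"
proof -
  define h :: "nat \<Rightarrow> 'a fps" where "h s = (\<Sum>l\<le>N. distinct_series l * ((fps_X\<^sup>2) ^ Suc s) ^ l)" for s
  have step: "eq_upto N ((1 - fps_X ^ (2 * (s + 1) + 1)) * h s) (h (Suc s))" for s
  proof -
    have X: "fps_X ^ (2 * (s + 1) + 1) = (fps_X * (fps_X\<^sup>2) ^ Suc s :: 'a fps)"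
    proof -
      have "fps_X ^ (2 * (s + 1) + 1) = (fps_X * fps_X ^ (2 * Suc s) :: 'a fps)" by simp
      then show ?thesis by (simp only: power_mult)
    qed
    have "(1 - fps_X ^ (2 * (s + 1) + 1)) * h s
        = h (Suc s) - fps_X * ((fps_X\<^sup>2) ^ Suc s) ^ Suc N * distinct_series N"
      using truncated_functional_equation[of "distinct_series :: nat \<Rightarrow> 'a fps" "fps_X\<^sup>2" fps_X "(fps_X\<^sup>2) ^ Suc s" N,
          OF distinct_series_rec]
      by (simp only: h_def X power_Suc[of "fps_X\<^sup>2" "Suc s"])
    also have "fps_X * ((fps_X\<^sup>2) ^ Suc s) ^ Suc N * distinct_series N
        = (fps_X ^ Suc (2 * Suc s * Suc N) * distinct_series N :: 'a fps)"
      by (simp only: power_Suc power_mult)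
    also have "eq_upto N (h (Suc s) - \<dots>) (h (Suc s) - 0)"
      by (intro eq_upto_diff eq_upto_refl eq_upto_X_power_mult) simp
    finally show ?thesis by simp
  qed
  \<comment> \<open>The argument \<open>t ^ Suc k\<close> has order \<open>2 * Suc k\<close>, more
    than \<open>N\<close>, so only the constant term of the series survives.\<close>
  have "eq_upto N (h k) (\<Sum>l\<le>N. distinct_series l * (if l = 0 then 1 else 0))"
    unfolding h_def
  proof (intro eq_upto_sum eq_upto_mult eq_upto_refl)
    fix l assume "l \<in> {..N}"
    have "eq_upto N (fps_X ^ (2 * Suc k * l) * 1) (0 :: 'a fps)" if "l \<noteq> 0"
      using that assms by (intro eq_upto_X_power_mult) (cases l, auto)
    then show "eq_upto N (((fps_X\<^sup>2) ^ Suc k) ^ l) (if l = 0 then 1 else 0 :: 'a fps)"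
    proof (cases "l = 0")
      case False
      then show ?thesis
        using \<open>l \<noteq> 0 \<Longrightarrow> eq_upto N (fps_X ^ (2 * Suc k * l) * 1) (0 :: 'a fps)\<close>
        by (simp only: power_mult mult_1_right if_False not_False_eq_True simp_thms)
    qed simp
  qed
  also have "\<dots> = distinct_series 0" by (simp add: mult_delta_right)
  also have "\<dots> = 1" using distinct_series_times_q_fact[of 0, where 'a = 'a] by simp
  finally have "eq_upto N (h k ^ k) (1 ^ k)" by (rule eq_upto_power)
  moreover have "eq_upto N ((\<Prod>s<k. h s) * (\<Prod>s<k. (1 - fps_X ^ (2 * (s + 1) + 1)) ^ Suc s)) (h k ^ k)"
    by (rule telescoping_product_upto[where h = h and c = "\<lambda>s. fps_X ^ (2 * (s + 1) + 1)"]) (rule step)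
  ultimately show ?thesis unfolding h_def[symmetric] using eq_upto_trans by fastforce
qed

section \<open>The product side and the formal theorem\<close>

lemma rank_gf_eq_rank_series: "rank_gf m = rank_series m"
  by (simp add: rank_gf_def rank_series_def)

lemma eq_upto_product_factor_fps: 
  assumes "N < 2 * n + 3"
  shows "eq_upto N (product_factor_fps n) 1"
proof -
  define A :: "rat fps" where "A = (1 - fps_X ^ (2 * (n + 1) + 1)) ^ (n + 1)"
  have A: "A * inverse A = 1"
    unfolding A_def by (intro inverse_mult_eq_1') (simp add: fps_power_zeroth)
  have "eq_upto N (1 - fps_X ^ (2 * (n + 1) + 1)) (1 - 0 :: rat fps)"
    using eq_upto_X_power_mult[of N "2 * (n + 1) + 1" "1 :: rat fps"] assms
    by (intro eq_upto_diff eq_upto_refl) simp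
  then have "eq_upto N A ((1 - 0) ^ (n + 1))" unfolding A_def by (rule eq_upto_power)
  then have "eq_upto N (A * inverse A) (1 * inverse A)" by (intro eq_upto_mult) simp_all
  then have "eq_upto N 1 (inverse A)" by (simp only: A mult_1_left)
  then show ?thesis unfolding product_factor_fps_def A_def[symmetric] by (rule eq_upto_sym)
qed

lemma product_factor_fps_times:
  "(\<Prod>n<k. (1 - fps_X ^ (2 * (n + 1) + 1)) ^ Suc n) * (\<Prod>n<k. product_factor_fps n) = 1"
proof -
  have "(1 - fps_X ^ (2 * (n + 1) + 1)) ^ Suc n * product_factor_fps n = 1" for n
    unfolding product_factor_fps_def Suc_eq_plus1 by (intro inverse_mult_eq_1') (simp add: fps_power_zeroth)
  then show ?thesis by (simp add: prod.distrib[symmetric])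
qed

text \<open>Up to degree \<open>N\<close> both truncations are harmless: \<open>f\<close> to its
  first \<open>k\<close> factors, and the sum over \<open>l\<close> at \<open>N\<close>. The
  determinant formula then applies over the domain of power series in \<open>q\<close>, with nodes
  told apart by their subdegrees, and gives an explicit threshold for stabilisation.\<close>

lemma eq_upto_toeplitz_det_rank_gf:
  assumes "N < 2 * k"
  shows "eq_upto N (toeplitz_det k rank_gf) (\<Prod>n<k. product_factor_fps n)"
proof -
  \<comment> \<open>Here the outer power series is in \<open>z\<close>, and its coefficients are
    power series in \<open>q\<close>.\<close>
  define F where "F = (\<Prod>s<k. geometric_fps ((fps_X\<^sup>2) ^ Suc s) :: rat fps fps)"
  have inj: "inj_on (\<lambda>s. (fps_X\<^sup>2) ^ Suc s :: rat fps) {..<k}"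
  proof (rule inj_onI)
    fix s s' assume "(fps_X\<^sup>2) ^ Suc s = ((fps_X\<^sup>2) ^ Suc s' :: rat fps)"
    then have "subdegree (fps_X ^ (2 * Suc s) :: rat fps) = subdegree (fps_X ^ (2 * Suc s') :: rat fps)"
      by (simp only: power_mult)
    then show "s = s'" unfolding fps_X_power_subdegree by simp
  qed
  have "eq_upto N (toeplitz_det k rank_gf)
      (toeplitz_det k (\<lambda>m. \<Sum>l\<le>N. int_coeff F (m + int l) * distinct_series l))"
  proof (rule eq_upto_toeplitz_det)
    fix m
    have "eq_upto N (rank_gf m) (\<Sum>l\<le>N. max_part_series (m + int l) * distinct_series l)"
      unfolding rank_gf_eq_rank_series by (rule eq_upto_rank_series) simp
    also have "eq_upto N \<dots> (\<Sum>l\<le>N. int_coeff F (m + int l) * distinct_series l)"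
      unfolding F_def by (intro eq_upto_sum eq_upto_mult eq_upto_refl eq_upto_max_part_series assms)
    finally show "eq_upto N (rank_gf m) (\<Sum>l\<le>N. int_coeff F (m + int l) * distinct_series l)" .
  qed
  also have "toeplitz_det k (\<lambda>m. \<Sum>l\<le>N. int_coeff F (m + int l) * distinct_series l)
      = (\<Prod>s<k. \<Sum>l\<le>N. distinct_series l * ((fps_X\<^sup>2) ^ Suc s) ^ l)" (is "_ = ?D")
    unfolding F_def by (rule toeplitz_det_rational_symbol[OF inj])
  also have "?D = ?D * (\<Prod>n<k. (1 - fps_X ^ (2 * (n + 1) + 1)) ^ Suc n) * (\<Prod>n<k. product_factor_fps n)"
    by (simp only: mult.assoc product_factor_fps_times mult_1_right)
  also have "eq_upto N \<dots> (1 * (\<Prod>n<k. product_factor_fps n))"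
    by (intro eq_upto_mult eq_upto_prod_distinct_series eq_upto_refl assms)
  finally show ?thesis by simp
qed

lemma eq_upto_prod_product_factor_fps:
  assumes "N \<le> k"
  shows "eq_upto N (\<Prod>n<k. product_factor_fps n) (\<Prod>n<N. product_factor_fps n)"
  using assms
proof (induction k rule: dec_induct)
  case (step k)
  have "eq_upto N ((\<Prod>n<k. product_factor_fps n) * product_factor_fps k) ((\<Prod>n<N. product_factor_fps n) * 1)"
    using step by (intro eq_upto_mult eq_upto_product_factor_fps) auto
  then show ?case by simp
qed simp

text \<open>A diagonal construction: the factor with index \<open>n\<close> differs from 1 only in
  degrees from \<open>2 * n + 3\<close> on, so the coefficient of degree \<open>N\<close> is settled
  after \<open>N\<close> factors.\<close>

definition product_fps :: "rat fps" where
  "product_fps = Abs_fps (\<lambda>N. fps_nth (\<Prod>n<N. product_factor_fps n) N)"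

lemma eq_upto_product_fps:
  assumes "N \<le> k"
  shows "eq_upto N (\<Prod>n<k. product_factor_fps n) product_fps"
  unfolding eq_upto_def product_fps_def
proof (intro allI impI)
  fix n assume "n \<le> N"
  then show "fps_nth (\<Prod>n<k. product_factor_fps n) n = fps_nth (Abs_fps (\<lambda>N. fps_nth (\<Prod>n<N. product_factor_fps n) N)) n"
    using eq_upto_prod_product_factor_fps[of n k] assms by (simp add: eq_upto_def)
qed

lemma raw_has_prod_product_factor_fps: "raw_has_prod product_factor_fps 0 product_fps"
proof -
  have "(\<lambda>n. \<Prod>i\<le>n. product_factor_fps i) \<longlonglongrightarrow> product_fps"
  proof (rule tendsto_fpsI)
    fix N
    show "eventually (\<lambda>n. fps_nth (\<Prod>i\<le>n. product_factor_fps i) N = fps_nth product_fps N) sequentially"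
      using eventually_ge_at_top[of N]
    proof eventually_elim
      case (elim n)
      then show ?case
        using eq_upto_product_fps[of N "Suc n"] by (simp only: eq_upto_def lessThan_Suc_atMost)
    qed
  qed
  \<comment> \<open>Convergence of an infinite product requires a nonzero limit, which the constant
    term provides.\<close>
  moreover have "fps_nth product_fps 0 = 1" by (simp add: product_fps_def)
  ultimately show ?thesis by (auto simp: raw_has_prod_def)
qed

theorem toeplitz_det_formal_limit:
  "convergent_prod product_factor_fps \<and>
   (\<forall>N. \<forall>\<^sub>F k in sequentially. fps_nth (toeplitz_det k rank_gf) N = fps_nth (prodinf product_factor_fps) N)"
proof (intro conjI allI)
  show "convergent_prod product_factor_fps"
    using raw_has_prod_product_factor_fps unfolding convergent_prod_def by blast
  have P: "prodinf product_factor_fps = product_fps"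
    using raw_has_prod_product_factor_fps by (intro has_prod_unique[symmetric]) (simp add: has_prod_def)
  fix N
  show "\<forall>\<^sub>F k in sequentially. fps_nth (toeplitz_det k rank_gf) N = fps_nth (prodinf product_factor_fps) N"
    using eventually_gt_at_top[of N]
  proof eventually_elim
    case (elim k)
    then have "eq_upto N (toeplitz_det k rank_gf) product_fps"
      using eq_upto_trans[OF eq_upto_toeplitz_det_rank_gf eq_upto_product_fps] by simp
    then show ?case by (simp add: P eq_upto_def)
  qed
qed

section \<open>Stability of Toeplitz determinants\<close>

text \<open>The bound is kept as a difference of products, the form in which it can be summed over
  all permutations and collapsed into row sums. The second conclusion is there to carry the
  induction.\<close>

lemma norm_prod_diff_le:
  fixes a b :: "'b \<Rightarrow> 'a :: {real_normed_algebra_1, comm_ring_1}"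
  assumes "finite S"
  shows "norm (prod b S - prod a S) \<le> (\<Prod>i\<in>S. norm (a i) + norm (b i - a i)) - (\<Prod>i\<in>S. norm (a i))
       \<and> norm (prod b S) \<le> (\<Prod>i\<in>S. norm (a i) + norm (b i - a i))"
  using assms
proof (induction S rule: finite_induct)
  case (insert x S)
  let ?F = "\<Prod>i\<in>S. norm (a i) + norm (b i - a i)"
  have "norm (b x) \<le> norm (a x) + norm (b x - a x)"
    using norm_triangle_ineq[of "a x" "b x - a x"] by simp
  then have 1: "norm (b x * prod b S) \<le> (norm (a x) + norm (b x - a x)) * ?F"
    using insert.IH by (intro order.trans[OF norm_mult_ineq] mult_mono) auto
  have "b x * prod b S - a x * prod a S = (b x - a x) * prod b S + a x * (prod b S - prod a S)"
    by (simp add: algebra_simps)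
  then have "norm (b x * prod b S - a x * prod a S)
      \<le> norm ((b x - a x) * prod b S) + norm (a x * (prod b S - prod a S))"
    by (simp only: norm_triangle_ineq)
  also have "\<dots> \<le> norm (b x - a x) * ?F + norm (a x) * (?F - (\<Prod>i\<in>S. norm (a i)))"
    using insert.IH by (intro add_mono order.trans[OF norm_mult_ineq] mult_left_mono) auto
  finally show ?case using 1 insert.hyps by (simp add: algebra_simps)
qed auto

text \<open>Expanded, the difference consists of nonnegative products with at least one factor
  \<open>e i\<close>, so it grows with all data. This permits replacing row sums by upper bounds for
  them.\<close>

lemma prod_add_diff_mono:
  fixes a a' e e' :: "'b \<Rightarrow> real"
  assumes "finite S" "\<And>i. i \<in> S \<Longrightarrow> 0 \<le> a i \<and> a i \<le> a' i" "\<And>i. i \<in> S \<Longrightarrow> 0 \<le> e i \<and> e i \<le> e' i"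
  shows "(\<Prod>i\<in>S. a i + e i) - prod a S \<le> (\<Prod>i\<in>S. a' i + e' i) - prod a' S"
  using assms
proof (induction S rule: finite_induct)
  case (insert x S)
  let ?X = "\<Prod>i\<in>S. a i + e i" and ?X' = "\<Prod>i\<in>S. a' i + e' i"
  have le: "0 \<le> ?X" "?X \<le> ?X'" "prod a S \<le> ?X"
    using insert.prems by (auto intro!: prod_nonneg prod_mono add_mono add_nonneg_nonneg)
  have nonneg: "0 \<le> a' x" "0 \<le> e' x"
    using insert.prems(1)[of x] insert.prems(2)[of x] by auto
  have "a x * (?X - prod a S) \<le> a' x * (?X' - prod a' S)"
    using insert.prems le nonneg by (intro mult_mono insert.IH) auto
  moreover have "e x * ?X \<le> e' x * ?X'"
    using insert.prems le nonneg by (intro mult_mono) auto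
  ultimately show ?case using insert.hyps by (simp add: algebra_simps)
qed simp

text \<open>Multiplying out the row sums produces one summand for each map of the index set to
  itself. Permutations are among these maps, and all other summands are nonnegative.\<close>

lemma sum_permutes_le_prod_sum:
  fixes F G :: "nat \<Rightarrow> nat \<Rightarrow> real"
  assumes "\<And>i j. 0 \<le> G i j" "\<And>i j. G i j \<le> F i j"
  shows "(\<Sum>\<pi> | \<pi> permutes {0..<n}. (\<Prod>i<n. F i (\<pi> i)) - (\<Prod>i<n. G i (\<pi> i)))
       \<le> (\<Prod>i<n. \<Sum>j<n. F i j) - (\<Prod>i<n. \<Sum>j<n. G i j)"
proof -
  define D where "D \<phi> = (\<Prod>i<n. F i (\<phi> i)) - (\<Prod>i<n. G i (\<phi> i))" for \<phi>
  let ?P = "{\<pi>. \<pi> permutes {0..<n}}"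
  \<comment> \<open>Permutations are the identity outside the index set, whereas extensional
    functions are undefined there; restriction translates between the two.\<close>
  have inj: "inj_on (\<lambda>\<pi>. restrict \<pi> {..<n}) ?P"
  proof (rule inj_onI)
    fix \<pi> \<sigma> assume p: "\<pi> \<in> ?P" "\<sigma> \<in> ?P" and eq: "restrict \<pi> {..<n} = restrict \<sigma> {..<n}"
    show "\<pi> = \<sigma>"
    proof
      fix i
      show "\<pi> i = \<sigma> i"
      proof (cases "i < n")
        case True then show ?thesis using fun_cong[OF eq, of i] by simp
      next
        case False then show ?thesis using p by (simp add: permutes_def)
      qed
    qed
  qed
  have "(\<Sum>\<pi>\<in>?P. D \<pi>) = (\<Sum>\<pi>\<in>?P. D (restrict \<pi> {..<n}))"
    unfolding D_def by (intro sum.cong refl arg_cong2[of _ _ _ _ "(-)"] prod.cong) auto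
  also have "\<dots> = (\<Sum>\<phi>\<in>(\<lambda>\<pi>. restrict \<pi> {..<n}) ` ?P. D \<phi>)"
    by (simp add: sum.reindex[OF inj])
  also have "\<dots> \<le> (\<Sum>\<phi>\<in>{..<n} \<rightarrow>\<^sub>E {..<n}. D \<phi>)"
  proof (rule sum_mono2)
    show "finite ({..<n} \<rightarrow>\<^sub>E {..<n})" by (intro finite_PiE) auto
    show "(\<lambda>\<pi>. restrict \<pi> {..<n}) ` ?P \<subseteq> {..<n} \<rightarrow>\<^sub>E {..<n}"
    proof (rule image_subsetI)
      fix \<pi> assume "\<pi> \<in> ?P"
      then have "\<pi> i < n" if "i < n" for i
        using permutes_in_image[of \<pi> "{0..<n}" i] that by simp
      then show "restrict \<pi> {..<n} \<in> {..<n} \<rightarrow>\<^sub>E {..<n}" by auto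
    qed
    show "0 \<le> D \<phi>" for \<phi> unfolding D_def using assms by (simp add: prod_mono)
  qed
  also have "\<dots> = (\<Prod>i<n. \<Sum>j<n. F i j) - (\<Prod>i<n. \<Sum>j<n. G i j)"
    by (simp add: D_def sum_subtractf prod_sum_PiE)
  finally show ?thesis unfolding D_def .
qed

text \<open>Only row sums enter. The estimate stays useful as \<open>n\<close> grows because it will
  be applied with \<open>\<alpha> i = 1 + \<beta> i\<close> for a summable \<open>\<beta>\<close>,
  whose products are bounded uniformly in \<open>n\<close>.\<close>

lemma det_perturbation:
  fixes A B :: "complex mat"
  assumes A: "A \<in> carrier_mat n n" and B: "B \<in> carrier_mat n n"
    and a: "\<And>i. i < n \<Longrightarrow> (\<Sum>j<n. norm (A $$ (i, j))) \<le> \<alpha> i"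
    and e: "\<And>i. i < n \<Longrightarrow> (\<Sum>j<n. norm (B $$ (i, j) - A $$ (i, j))) \<le> \<epsilon> i"
  shows "norm (Determinant.det B - Determinant.det A) \<le> (\<Prod>i<n. \<alpha> i + \<epsilon> i) - (\<Prod>i<n. \<alpha> i)"
proof -
  define F where "F i j = norm (A $$ (i, j)) + norm (B $$ (i, j) - A $$ (i, j))" for i j
  let ?P = "{\<pi>. \<pi> permutes {0..<n}}"
  have eq: "Determinant.det B - Determinant.det A
      = (\<Sum>\<pi>\<in>?P. signof \<pi> * ((\<Prod>i<n. B $$ (i, \<pi> i)) - (\<Prod>i<n. A $$ (i, \<pi> i))))"
    by (simp add: det_def'[OF A] det_def'[OF B] atLeast0LessThan sum_subtractf right_diff_distrib)
  have "norm (Determinant.det B - Determinant.det A) \<le> (\<Sum>\<pi>\<in>?P. (\<Prod>i<n. F i (\<pi> i)) - (\<Prod>i<n. norm (A $$ (i, \<pi> i))))"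
    unfolding eq
  proof (rule sum_norm_le)
    fix \<pi>
    have "norm (signof \<pi> :: complex) = 1" by (simp add: sign_def)
    then show "norm (signof \<pi> * ((\<Prod>i<n. B $$ (i, \<pi> i)) - (\<Prod>i<n. A $$ (i, \<pi> i))))
        \<le> (\<Prod>i<n. F i (\<pi> i)) - (\<Prod>i<n. norm (A $$ (i, \<pi> i)))"
      unfolding norm_mult F_def
      using norm_prod_diff_le[of "{..<n}" "\<lambda>i. B $$ (i, \<pi> i)" "\<lambda>i. A $$ (i, \<pi> i)"] by simp
  qed
  also have "\<dots> \<le> (\<Prod>i<n. \<Sum>j<n. F i j) - (\<Prod>i<n. \<Sum>j<n. norm (A $$ (i, j)))"
    by (rule sum_permutes_le_prod_sum) (simp_all add: F_def)
  also have "\<dots> = (\<Prod>i<n. (\<Sum>j<n. norm (A $$ (i, j))) + (\<Sum>j<n. norm (B $$ (i, j) - A $$ (i, j))))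
      - (\<Prod>i<n. \<Sum>j<n. norm (A $$ (i, j)))"
    by (simp add: F_def sum.distrib)
  also have "\<dots> \<le> (\<Prod>i<n. \<alpha> i + \<epsilon> i) - (\<Prod>i<n. \<alpha> i)"
    using a e by (intro prod_add_diff_mono) (auto intro: sum_nonneg)
  finally show ?thesis .
qed

section \<open>Triangular Toeplitz matrices and the Wiener-Hopf splitting\<close>

definition lower_toeplitz :: "nat \<Rightarrow> 'a :: comm_ring_1 fps \<Rightarrow> 'a mat" where
  "lower_toeplitz k A = Matrix.mat k k (\<lambda>(i, j). int_coeff A (int i - int j))"

lemma lower_toeplitz_carrier [simp]: "lower_toeplitz k A \<in> carrier_mat k k"
  by (simp add: lower_toeplitz_def)

lemma det_lower_toeplitz: "fps_nth A 0 = 1 \<Longrightarrow> Determinant.det (lower_toeplitz k A) = 1"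
  using toeplitz_det_unipotent[of A k] by (simp add: toeplitz_det_def lower_toeplitz_def)

text \<open>The convolution in an entry runs only through indices between column and row, so cutting
  to size \<open>k\<close> loses nothing, and inverse series give inverse matrices at every
  size.\<close>

lemma lower_toeplitz_mult: "lower_toeplitz k A * lower_toeplitz k B = lower_toeplitz k (A * B)"
proof (rule eq_matI)
  fix i j assume "i < dim_row (lower_toeplitz k (A * B))" "j < dim_col (lower_toeplitz k (A * B))"
  then have ij: "i < k" "j < k" by (simp_all add: lower_toeplitz_def)
  have "(lower_toeplitz k A * lower_toeplitz k B) $$ (i, j)
      = (\<Sum>m<k. int_coeff A (int i - int m) * int_coeff B (int m - int j))"
    using ij by (simp add: lower_toeplitz_def scalar_prod_def atLeast0LessThan)
  also have "\<dots> = (\<Sum>m\<in>{j..i}. int_coeff A (int i - int m) * int_coeff B (int m - int j))"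
    using ij by (intro sum.mono_neutral_right) (auto simp: int_coeff_def)
  also have "\<dots> = int_coeff (A * B) (int i - int j)"
  proof (cases "j \<le> i")
    case True
    have "(\<Sum>m\<in>{j..i}. int_coeff A (int i - int m) * int_coeff B (int m - int j))
        = (\<Sum>m\<in>{0..i - j}. fps_nth A m * fps_nth B (i - j - m))"
      using True by (intro sum.reindex_bij_witness[of _ "\<lambda>m. i - m" "\<lambda>m. i - m"])
        (auto simp: int_coeff_def nat_diff_distrib)
    then show ?thesis using True by (simp add: int_coeff_def fps_mult_nth nat_diff_distrib)
  qed (simp add: int_coeff_def)
  finally show "(lower_toeplitz k A * lower_toeplitz k B) $$ (i, j) = lower_toeplitz k (A * B) $$ (i, j)"
    using ij by (simp add: lower_toeplitz_def)
qed (simp_all add: lower_toeplitz_def)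

lemma lower_toeplitz_1: "lower_toeplitz k 1 = 1\<^sub>m k"
  by (rule eq_matI) (auto simp: lower_toeplitz_def int_coeff_def)

text \<open>The Laurent coefficient of \<open>f z * g (1 / z)\<close> at
  \<open>z ^ m\<close>.\<close>

definition symbol_coeff :: "complex fps \<Rightarrow> complex fps \<Rightarrow> int \<Rightarrow> complex" where
  "symbol_coeff f g m = (\<Sum>l. int_coeff f (m + int l) * fps_nth g l)"

lemma norm_int_coeff_le:
  assumes "\<And>m. norm (fps_nth f m) \<le> C" "0 \<le> C"
  shows "norm (int_coeff f m) \<le> C"
  using assms by (simp add: int_coeff_def)

lemma summable_symbol_coeff:
  fixes f g :: "complex fps"
  assumes f: "\<And>m. norm (fps_nth f m) \<le> D" and g: "\<And>m. norm (fps_nth g m) \<le> C * r ^ m"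
    and r: "0 \<le> r" "r < 1"
  shows "summable (\<lambda>l. int_coeff f (m + int l) * fps_nth g l)"
    and "norm (symbol_coeff f g m) \<le> D * C / (1 - r)"
proof -
  have D: "0 \<le> D" using order.trans[OF norm_ge_zero f[of 0]] .
  have C: "0 \<le> C" using order.trans[OF norm_ge_zero g[of 0]] by simp
  have le: "norm (int_coeff f (m + int l) * fps_nth g l) \<le> D * C * r ^ l" for l
    unfolding norm_mult mult.assoc using D C r by (intro mult_mono norm_int_coeff_le f g) auto
  have sm: "summable (\<lambda>l. D * C * r ^ l)"
    using r by (intro summable_mult summable_geometric) simp
  show s: "summable (\<lambda>l. int_coeff f (m + int l) * fps_nth g l)"
    by (rule summable_comparison_test'[OF sm]) (use le in auto)
  have "norm (symbol_coeff f g m) \<le> (\<Sum>l. D * C * r ^ l)"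
    unfolding symbol_coeff_def by (rule norm_suminf_le[OF le sm])
  also have "\<dots> = D * C / (1 - r)"
    using r by (simp add: suminf_mult suminf_geometric summable_geometric)
  finally show "norm (symbol_coeff f g m) \<le> D * C / (1 - r)" .
qed

lemma symbol_coeff_diff:
  fixes f f' g :: "complex fps"
  assumes f: "\<And>m. norm (fps_nth f m) \<le> D" and f': "\<And>m. norm (fps_nth f' m) \<le> D'"
    and g: "\<And>m. norm (fps_nth g m) \<le> C * r ^ m" and r: "0 \<le> r" "r < 1"
  shows "symbol_coeff f g m - symbol_coeff f' g m = symbol_coeff (f - f') g m"
proof -
  have "int_coeff (f - f') j = int_coeff f j - int_coeff f' j" for j
    by (simp add: int_coeff_def)
  then show ?thesis
    unfolding symbol_coeff_def
    by (subst suminf_diff[OF summable_symbol_coeff(1)[OF f g r] summable_symbol_coeff(1)[OF f' g r]])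
       (simp add: left_diff_distrib)
qed

text \<open>The Wiener--Hopf splitting: the Toeplitz matrix of a product of a series in \<open>z\<close> and a series in
  \<open>1/z\<close> is a product of triangular Toeplitz matrices plus a product of Hankel matrices.\<close>

lemma toeplitz_symbol_splitting:
  fixes f g :: "complex fps"
  assumes f: "\<And>m. norm (fps_nth f m) \<le> D" and g: "\<And>m. norm (fps_nth g m) \<le> C * r ^ m"
    and r: "0 \<le> r" "r < 1"
  shows "Matrix.mat k k (\<lambda>(i, j). symbol_coeff f g (int i - int j))
     = lower_toeplitz k f * transpose_mat (lower_toeplitz k g)
       + Matrix.mat k k (\<lambda>(i, j). \<Sum>w. fps_nth f (i + w + 1) * fps_nth g (j + w + 1))"
proof (rule eq_matI, goal_cases)
  case (1 i j)
  then have ij: "i < k" "j < k" by simp_all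
  have "(lower_toeplitz k f * transpose_mat (lower_toeplitz k g)) $$ (i, j)
      = (\<Sum>v<k. int_coeff f (int i - int v) * int_coeff g (int j - int v))"
    using ij by (simp add: lower_toeplitz_def scalar_prod_def atLeast0LessThan)
  also have "\<dots> = (\<Sum>v\<in>{..j}. int_coeff f (int i - int v) * int_coeff g (int j - int v))"
    using ij by (intro sum.mono_neutral_right) (auto simp: int_coeff_def)
  also have "\<dots> = (\<Sum>l<Suc j. int_coeff f (int i - int j + int l) * fps_nth g l)"
    by (intro sum.reindex_bij_witness[of _ "\<lambda>l. j - l" "\<lambda>v. j - v"])
       (auto simp: int_coeff_def[of g] nat_diff_distrib of_nat_diff algebra_simps)
  finally have "(lower_toeplitz k f * transpose_mat (lower_toeplitz k g)) $$ (i, j)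
      = (\<Sum>l<Suc j. int_coeff f (int i - int j + int l) * fps_nth g l)" .
  moreover have "symbol_coeff f g (int i - int j)
      = (\<Sum>w. int_coeff f (int i - int j + int (w + Suc j)) * fps_nth g (w + Suc j))
        + (\<Sum>l<Suc j. int_coeff f (int i - int j + int l) * fps_nth g l)"
    \<comment> \<open>The terms with \<open>l \<le> j\<close> make up the triangular product; in all
      later ones the index of \<open>f\<close> is positive, and they form the Hankel
      product.\<close>
    unfolding symbol_coeff_def
    by (rule suminf_split_initial_segment[OF summable_symbol_coeff(1)[OF f g r]])
  moreover have "int_coeff f (int i - int j + int (w + Suc j)) = fps_nth f (i + w + 1)" for w
    by (simp add: int_coeff_def nat_add_distrib nat_eq_iff)
  ultimately show ?case using ij by (simp add: lower_toeplitz_def add_ac)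
qed (simp_all add: lower_toeplitz_def)

text \<open>A majorant of product form \<open>\<eta> m * \<theta> m'\<close> lets the left and right
  triangular factors act separately.\<close>

lemma norm_lower_toeplitz_sandwich_le:
  fixes p \<gamma> :: "complex fps"
  assumes E: "E \<in> carrier_mat k k"
    and le: "\<And>m m'. m < k \<Longrightarrow> m' < k \<Longrightarrow> norm (E $$ (m, m')) \<le> \<eta> m * \<theta> m'"
    and ij: "i < k" "j < k"
  shows "norm ((lower_toeplitz k p * E * transpose_mat (lower_toeplitz k \<gamma>)) $$ (i, j))
     \<le> (\<Sum>m<k. norm (int_coeff p (int i - int m)) * \<eta> m) * (\<Sum>m<k. norm (int_coeff \<gamma> (int j - int m)) * \<theta> m)"
proof -
  have eq: "(lower_toeplitz k p * E * transpose_mat (lower_toeplitz k \<gamma>)) $$ (i, j)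
      = (\<Sum>m'<k. (\<Sum>m<k. int_coeff p (int i - int m) * E $$ (m, m')) * int_coeff \<gamma> (int j - int m'))"
    using ij E by (simp add: lower_toeplitz_def scalar_prod_def atLeast0LessThan)
  have "norm ((lower_toeplitz k p * E * transpose_mat (lower_toeplitz k \<gamma>)) $$ (i, j))
      \<le> (\<Sum>m'<k. (\<Sum>m<k. norm (int_coeff p (int i - int m)) * (\<eta> m * \<theta> m')) * norm (int_coeff \<gamma> (int j - int m')))"
    unfolding eq
    by (intro sum_norm_le order.trans[OF norm_mult_ineq] mult_right_mono)
       (auto simp: norm_mult intro!: sum_norm_le mult_left_mono le)
  also have "\<dots> = (\<Sum>m<k. norm (int_coeff p (int i - int m)) * \<eta> m) * (\<Sum>m<k. norm (int_coeff \<gamma> (int j - int m)) * \<theta> m)"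
    by (subst sum_product, subst sum.swap) (simp add: sum_distrib_left sum_distrib_right mult_ac)
  finally show ?thesis .
qed

context
  fixes C r :: real and p :: "complex fps"
  assumes p: "\<And>m. norm (fps_nth p m) \<le> C * r ^ m" and r: "0 \<le> r" "r < 1"
begin

lemma decay_const_nonneg: "0 \<le> C"
  using order.trans[OF norm_ge_zero p[of 0]] by simp

lemma norm_int_coeff_decay:
  "norm (int_coeff p (int i - int m)) \<le> (if m \<le> i then C * r ^ (i - m) else 0)"
  using p[of "i - m"] by (simp add: int_coeff_def nat_diff_distrib)

text \<open>Convolving two geometric sequences of equal ratio gives \<open>Suc i\<close> equal
  terms; this is where the linear factor comes from.\<close>

lemma sum_norm_int_coeff_power_le:
  assumes "i < k"
  shows "(\<Sum>m<k. norm (int_coeff p (int i - int m)) * r ^ m) \<le> C * (real (Suc i) * r ^ i)"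
proof -
  have "(\<Sum>m<k. norm (int_coeff p (int i - int m)) * r ^ m) \<le> (\<Sum>m<k. if m \<le> i then C * r ^ i else 0)"
  proof (rule sum_mono)
    fix m
    have "norm (int_coeff p (int i - int m)) * r ^ m \<le> (if m \<le> i then C * r ^ (i - m) else 0) * r ^ m"
      using r by (intro mult_right_mono norm_int_coeff_decay) auto
    then show "norm (int_coeff p (int i - int m)) * r ^ m \<le> (if m \<le> i then C * r ^ i else 0)"
      by (auto simp: power_add[symmetric] mult.assoc split: if_splits)
  qed
  also have "\<dots> = (\<Sum>m\<in>{..i}. C * r ^ i)"
    using assms by (intro sum.mono_neutral_cong_right) auto
  finally show ?thesis by (simp add: algebra_simps)
qed

lemma sum_norm_int_coeff_le:
  assumes "i < k"
  shows "(\<Sum>m<k. norm (int_coeff p (int i - int m))) \<le> C / (1 - r)"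
proof -
  have "(\<Sum>m<k. norm (int_coeff p (int i - int m))) \<le> (\<Sum>m<k. if m \<le> i then C * r ^ (i - m) else 0)"
    by (intro sum_mono norm_int_coeff_decay)
  also have "\<dots> = (\<Sum>m\<in>{..i}. C * r ^ (i - m))"
    using assms by (intro sum.mono_neutral_cong_right) auto
  also have "\<dots> = C * (\<Sum>m<Suc i. r ^ m)"
    unfolding sum_distrib_left
    by (intro sum.reindex_bij_witness[of _ "\<lambda>m. i - m" "\<lambda>m. i - m"]) auto
  also have "\<dots> \<le> C * (\<Sum>m. r ^ m)"
    using r decay_const_nonneg by (intro mult_left_mono sum_le_suminf summable_geometric) auto
  finally show ?thesis using r by (simp add: suminf_geometric)
qed

end

lemma sum_Suc_times_power_le:
  assumes "0 \<le> r" "r < (1 :: real)"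
  shows "(\<Sum>j<k. real (Suc j) * r ^ j) \<le> 1 / (1 - r)\<^sup>2"
proof -
  have s: "(\<lambda>n. of_nat (Suc n) * r ^ n) sums (1 / (1 - r)\<^sup>2)"
    using assms by (intro geometric_deriv_sums) auto
  show ?thesis
    unfolding sums_unique[OF s] using assms s by (intro sum_le_suminf) (auto simp: sums_iff)
qed

text \<open>By \<open>1 + \<beta> i + e \<le> (1 + \<beta> i) * (1 + e)\<close> the summable part
  costs a constant independent of \<open>k\<close>, and only the uniform error \<open>e\<close> is
  raised to the power \<open>k\<close>.\<close>

lemma prod_add_const_minus_le:
  fixes \<beta> :: "nat \<Rightarrow> real"
  assumes "\<And>i. 0 \<le> \<beta> i" "0 \<le> e" "(\<Sum>i<k. \<beta> i) \<le> B"
  shows "(\<Prod>i<k. 1 + \<beta> i + e) - (\<Prod>i<k. 1 + \<beta> i) \<le> exp B * (exp (real k * e) - 1)"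
proof -
  have "(\<Prod>i<k. 1 + \<beta> i + e) \<le> (\<Prod>i<k. (1 + \<beta> i) * (1 + e))"
    using assms by (intro prod_mono) (auto simp: algebra_simps)
  also have "\<dots> = (\<Prod>i<k. 1 + \<beta> i) * (1 + e) ^ k" by (simp add: prod.distrib)
  finally have "(\<Prod>i<k. 1 + \<beta> i + e) - (\<Prod>i<k. 1 + \<beta> i) \<le> (\<Prod>i<k. 1 + \<beta> i) * ((1 + e) ^ k - 1)"
    by (simp add: algebra_simps)
  also have "\<dots> \<le> exp B * (exp (real k * e) - 1)"
  proof (intro mult_mono diff_right_mono)
    have "(\<Prod>i<k. 1 + \<beta> i) \<le> (\<Prod>i<k. exp (\<beta> i))"
      using assms by (intro prod_mono) (auto simp: add_nonneg_nonneg)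
    also have "\<dots> = exp (\<Sum>i<k. \<beta> i)" by (simp add: exp_sum)
    also have "\<dots> \<le> exp B" using assms by simp
    finally show "(\<Prod>i<k. 1 + \<beta> i) \<le> exp B" .
    have "(1 + e) ^ k \<le> exp e ^ k" using assms by (intro power_mono) auto
    then show "(1 + e) ^ k \<le> exp (real k * e)" by (simp add: exp_of_nat_mult)
    show "0 \<le> (1 + e) ^ k - 1" using assms by simp
  qed simp
  finally show ?thesis .
qed

lemma mult_add_mult_mat:
  fixes A B C D :: "'a :: comm_ring_1 mat"
  assumes "A \<in> carrier_mat k k" "B \<in> carrier_mat k k" "C \<in> carrier_mat k k" "D \<in> carrier_mat k k"
  shows "A * (B + C) * D = A * B * D + A * C * D"
proof -
  have "A * (B + C) = A * B + A * C"
    by (rule mult_add_distrib_mat[OF assms(1-3)])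
  then show ?thesis
    using assms by (simp add: add_mult_distrib_mat[of _ k k _ _ k] mult_carrier_mat[where n = k])
qed

text \<open>Conjugating by the triangular Toeplitz matrices of \<open>1/f\<close> and \<open>1/g\<close>, which have determinant 1, turns
  the Toeplitz matrix into the identity plus a matrix whose entries decay exponentially in both
  indices; this makes the determinants stable under uniformly small perturbations of \<open>f\<close>.\<close>

theorem toeplitz_det_symbol_perturbation:
  fixes f g p \<gamma> :: "complex fps" and F :: "nat \<Rightarrow> complex fps" and D :: "nat \<Rightarrow> real"
  assumes inv: "p * f = 1" "\<gamma> * g = 1" and unit: "fps_nth p 0 = 1" "fps_nth \<gamma> 0 = 1"
    and r: "0 \<le> r" "r < 1"
    and f: "\<And>m. norm (fps_nth f m) \<le> C * r ^ m" and g: "\<And>m. norm (fps_nth g m) \<le> C * r ^ m"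
    and p: "\<And>m. norm (fps_nth p m) \<le> C * r ^ m" and \<gamma>: "\<And>m. norm (fps_nth \<gamma> m) \<le> C * r ^ m"
    and F: "\<And>k m. norm (fps_nth (F k) m - fps_nth f m) \<le> D k"
    and D: "(\<lambda>k. (real k)\<^sup>2 * D k) \<longlonglongrightarrow> 0"
  shows "(\<lambda>k. toeplitz_det k (symbol_coeff (F k) g) - toeplitz_det k (symbol_coeff f g)) \<longlonglongrightarrow> 0"
proof -
  have C: "0 \<le> C" by (rule decay_const_nonneg[OF f r])
  have fC: "norm (fps_nth f m) \<le> C" for m
    using f[of m] C r mult_left_mono[of "r ^ m" 1 C] power_le_one[of r m] by simp
  have FC: "norm (fps_nth (F k) m) \<le> C + D k" for k m
    using F[of k m] fC[of m] norm_triangle_sub[of "fps_nth (F k) m" "fps_nth f m"] by linarith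
  have D0: "0 \<le> D k" for k using order.trans[OF norm_ge_zero F[of k 0]] .
  define X where "X k a = lower_toeplitz k p * Matrix.mat k k (\<lambda>(i, j). a (int i - int j))
      * transpose_mat (lower_toeplitz k \<gamma>)" for k and a :: "int \<Rightarrow> complex"
  have X: "X k a \<in> carrier_mat k k" for k a by (simp add: X_def mult_carrier_mat[where n = k])
  have det_X: "Determinant.det (X k a) = toeplitz_det k a" for k a
    by (simp add: X_def toeplitz_det_def det_mult[where n = k] det_transpose[where n = k] det_lower_toeplitz unit
        mult_carrier_mat[where n = k])
  define H where "H k = Matrix.mat k k (\<lambda>(i, j). \<Sum>w. fps_nth f (i + w + 1) * fps_nth g (j + w + 1))" for k
  define M where "M k = lower_toeplitz k p * H k * transpose_mat (lower_toeplitz k \<gamma>)" for k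
  have M: "M k \<in> carrier_mat k k" for k by (simp add: M_def H_def mult_carrier_mat[where n = k])
  have X_eq: "X k (symbol_coeff f g) = 1\<^sub>m k + M k" for k
  proof -
    have H: "H k \<in> carrier_mat k k" by (simp add: H_def)
    let ?P = "lower_toeplitz k p" and ?f = "lower_toeplitz k f"
    let ?g = "transpose_mat (lower_toeplitz k g)" and ?\<gamma> = "transpose_mat (lower_toeplitz k \<gamma>)"
    have c: "?P \<in> carrier_mat k k" "?f \<in> carrier_mat k k" "?g \<in> carrier_mat k k" "?\<gamma> \<in> carrier_mat k k"
      by simp_all
    have 1: "?P * ?f = 1\<^sub>m k" by (simp add: lower_toeplitz_mult inv lower_toeplitz_1)
    have "?g * ?\<gamma> = transpose_mat (lower_toeplitz k \<gamma> * lower_toeplitz k g)"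
      by (rule transpose_mult[symmetric, of _ k k _ k]) simp_all
    then have 2: "?g * ?\<gamma> = 1\<^sub>m k" by (simp add: lower_toeplitz_mult inv lower_toeplitz_1)
    have "X k (symbol_coeff f g) = ?P * (?f * ?g + H k) * ?\<gamma>"
      unfolding X_def H_def toeplitz_symbol_splitting[OF fC g r] ..
    also have "\<dots> = ?P * (?f * ?g) * ?\<gamma> + M k"
      unfolding M_def by (rule mult_add_mult_mat[OF c(1) mult_carrier_mat[OF c(2,3)] H c(4)])
    also have "?P * (?f * ?g) * ?\<gamma> = (?P * ?f) * (?g * ?\<gamma>)"
      using c by (simp add: assoc_mult_mat[of _ k k _ k _ k] mult_carrier_mat[where n = k])
    finally show ?thesis by (simp add: 1 2)
  qed
  \<comment> \<open>From the decay of both Hankel factors, summed as a geometric series over the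
    inner index.\<close>
  define K where "K = C\<^sup>2 / (1 - r)"
  have K: "0 \<le> K" using r by (simp add: K_def)
  have H_le: "norm (H k $$ (i, j)) \<le> (K * r ^ i) * r ^ j" if "i < k" "j < k" for k i j
  proof -
    have le: "norm (fps_nth f (i + w + 1) * fps_nth g (j + w + 1)) \<le> C\<^sup>2 * r ^ i * r ^ j * r ^ w" for w
    proof -
      have "norm (fps_nth f (i + w + 1) * fps_nth g (j + w + 1)) \<le> (C * r ^ (i + w + 1)) * (C * r ^ (j + w + 1))"
        unfolding norm_mult using C r by (intro mult_mono f g) auto
      also have "\<dots> = C\<^sup>2 * r ^ i * r ^ j * (r ^ w * r ^ (w + 2))"
        by (simp add: power_add power2_eq_square mult_ac)
      also have "\<dots> \<le> C\<^sup>2 * r ^ i * r ^ j * (r ^ w * 1)"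
        using r C by (intro mult_left_mono power_le_one) auto
      finally show ?thesis by simp
    qed
    have sm: "summable (\<lambda>w. C\<^sup>2 * r ^ i * r ^ j * r ^ w)"
      using r by (intro summable_mult summable_geometric) simp
    have "norm (H k $$ (i, j)) \<le> (\<Sum>w. C\<^sup>2 * r ^ i * r ^ j * r ^ w)"
      using that norm_suminf_le[OF le sm] by (simp add: H_def)
    also have "\<dots> = (K * r ^ i) * r ^ j"
      using r by (simp add: K_def suminf_mult suminf_geometric summable_geometric)
    finally show ?thesis .
  qed
  \<comment> \<open>\<open>K\<close> comes from the Hankel product, one \<open>C\<close> each from
    \<open>p\<close> and \<open>\<gamma>\<close>, and the denominator from summing the decay in
    \<open>j\<close> over the row.\<close>
  define \<beta> where "\<beta> i = C\<^sup>2 * K / (1 - r)\<^sup>2 * (real (Suc i) * r ^ i)" for i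
  have \<beta>: "0 \<le> \<beta> i" for i using C K r by (simp add: \<beta>_def)
  have row: "(\<Sum>j<k. norm (X k (symbol_coeff f g) $$ (i, j))) \<le> 1 + \<beta> i" if i: "i < k" for k i
  proof -
    have "(\<Sum>j<k. norm (M k $$ (i, j))) \<le> (\<Sum>j<k. (K * (C * (real (Suc i) * r ^ i))) * (C * (real (Suc j) * r ^ j)))"
    proof (rule sum_mono)
      fix j assume "j \<in> {..<k}"
      then have j: "j < k" by simp
      have "norm (M k $$ (i, j)) \<le> (\<Sum>m<k. norm (int_coeff p (int i - int m)) * (K * r ^ m))
          * (\<Sum>m<k. norm (int_coeff \<gamma> (int j - int m)) * r ^ m)"
        unfolding M_def by (rule norm_lower_toeplitz_sandwich_le[OF _ H_le i j]) (simp_all add: H_def)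
      also have "(\<Sum>m<k. norm (int_coeff p (int i - int m)) * (K * r ^ m))
          = K * (\<Sum>m<k. norm (int_coeff p (int i - int m)) * r ^ m)"
        by (simp add: sum_distrib_left mult_ac)
      also have "\<dots> * (\<Sum>m<k. norm (int_coeff \<gamma> (int j - int m)) * r ^ m)
          \<le> (K * (C * (real (Suc i) * r ^ i))) * (C * (real (Suc j) * r ^ j))"
        using K C r
        by (intro mult_mono mult_left_mono sum_norm_int_coeff_power_le[OF p r i] sum_norm_int_coeff_power_le[OF \<gamma> r j]
            mult_nonneg_nonneg sum_nonneg) auto
      finally show "norm (M k $$ (i, j)) \<le> (K * (C * (real (Suc i) * r ^ i))) * (C * (real (Suc j) * r ^ j))" .
    qed
    also have "\<dots> = (K * (C * (real (Suc i) * r ^ i))) * C * (\<Sum>j<k. real (Suc j) * r ^ j)"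
      by (simp add: sum_distrib_left mult.assoc)
    also have "\<dots> \<le> (K * (C * (real (Suc i) * r ^ i))) * C * (1 / (1 - r)\<^sup>2)"
      using K C r by (intro mult_left_mono sum_Suc_times_power_le mult_nonneg_nonneg) auto
    also have "\<dots> = \<beta> i" by (simp add: \<beta>_def power2_eq_square)
    finally have "(\<Sum>j<k. norm (M k $$ (i, j))) \<le> \<beta> i" .
    moreover have "(\<Sum>j<k. norm (X k (symbol_coeff f g) $$ (i, j)))
        \<le> (\<Sum>j<k. (if i = j then 1 else 0) + norm (M k $$ (i, j)))"
    proof (rule sum_mono)
      fix j assume "j \<in> {..<k}"
      then have "X k (symbol_coeff f g) $$ (i, j) = (if i = j then 1 else 0) + M k $$ (i, j)"
        using i M[of k] by (simp add: X_eq)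
      then show "norm (X k (symbol_coeff f g) $$ (i, j)) \<le> (if i = j then 1 else 0) + norm (M k $$ (i, j))"
        using norm_triangle_ineq[of 1 "M k $$ (i, j)"] by auto
    qed
    ultimately show ?thesis using i by (simp add: sum.distrib)
  qed
  \<comment> \<open>One factor \<open>C / (1 - r)\<close> for each of \<open>p\<close>,
    \<open>\<gamma>\<close> and \<open>g\<close>.\<close>
  define Q where "Q = (C / (1 - r)) ^ 3"
  have Q: "0 \<le> Q" using C r by (simp add: Q_def)
  \<comment> \<open>The \<open>k\<close> entries of a row contribute one factor \<open>k\<close>,
    and the product over all rows contributes another; hence the assumption on
    \<open>(real k)\<^sup>2 * D k\<close>.\<close>
  have diff: "(\<Sum>j<k. norm (X k (symbol_coeff (F k) g) $$ (i, j) - X k (symbol_coeff f g) $$ (i, j)))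
      \<le> real k * (Q * D k)" if i: "i < k" for k i
  proof -
    define E where "E = Matrix.mat k k (\<lambda>(i, j). symbol_coeff (F k - f) g (int i - int j))"
    have E: "E \<in> carrier_mat k k" by (simp add: E_def)
    have "Matrix.mat k k (\<lambda>(i, j). symbol_coeff (F k) g (int i - int j))
        = Matrix.mat k k (\<lambda>(i, j). symbol_coeff f g (int i - int j)) + E" (is "?S = ?T + E")
      by (rule eq_matI) (simp_all add: E_def symbol_coeff_diff[OF FC fC g r, symmetric])
    then have "X k (symbol_coeff (F k) g) = lower_toeplitz k p * (?T + E) * transpose_mat (lower_toeplitz k \<gamma>)"
      by (simp add: X_def)
    also have "\<dots> = X k (symbol_coeff f g) + lower_toeplitz k p * E * transpose_mat (lower_toeplitz k \<gamma>)"
      unfolding X_def by (rule mult_add_mult_mat[where k = k]) (simp_all add: E)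
    finally have eq: "X k (symbol_coeff (F k) g) $$ (i, j) - X k (symbol_coeff f g) $$ (i, j)
        = (lower_toeplitz k p * E * transpose_mat (lower_toeplitz k \<gamma>)) $$ (i, j)" if "j < k" for j
      using i that X[of k "symbol_coeff f g"] by (simp add: lower_toeplitz_def)
    have le: "norm (E $$ (m, m')) \<le> (D k * C / (1 - r)) * 1" if "m < k" "m' < k" for m m'
      using that F summable_symbol_coeff(2)[of "F k - f" "D k" g C r, OF _ g r] by (simp add: E_def)
    have "norm ((lower_toeplitz k p * E * transpose_mat (lower_toeplitz k \<gamma>)) $$ (i, j)) \<le> Q * D k"
      if j: "j < k" for j
    proof -
      have "norm ((lower_toeplitz k p * E * transpose_mat (lower_toeplitz k \<gamma>)) $$ (i, j))
        \<le> (\<Sum>m<k. norm (int_coeff p (int i - int m)) * (D k * C / (1 - r)))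
          * (\<Sum>m<k. norm (int_coeff \<gamma> (int j - int m)) * 1)"
        by (rule norm_lower_toeplitz_sandwich_le[OF E le i j])
      also have "\<dots> = (\<Sum>m<k. norm (int_coeff p (int i - int m))) * (D k * C / (1 - r))
          * (\<Sum>m<k. norm (int_coeff \<gamma> (int j - int m)))"
        by (simp only: mult_1_right sum_distrib_right[of _ _ "D k * C / (1 - r)", symmetric])
      also have "\<dots> \<le> (C / (1 - r)) * (D k * C / (1 - r)) * (C / (1 - r))"
        using C r D0[of k]
        by (intro mult_mono sum_norm_int_coeff_le[OF p r i] sum_norm_int_coeff_le[OF \<gamma> r j]) (auto intro: sum_nonneg)
      finally show ?thesis by (simp add: Q_def power3_eq_cube mult_ac)
    qed
    then have "(\<Sum>j<k. norm (X k (symbol_coeff (F k) g) $$ (i, j) - X k (symbol_coeff f g) $$ (i, j)))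
        \<le> (\<Sum>j<k. Q * D k)"
      by (intro sum_mono) (simp add: eq)
    then show ?thesis by simp
  qed
  define B where "B = C\<^sup>2 * K / (1 - r)\<^sup>2 * (1 / (1 - r)\<^sup>2)"
  have sum_\<beta>: "(\<Sum>i<k. \<beta> i) \<le> B" for k
    unfolding \<beta>_def B_def sum_distrib_left[symmetric]
    using C K r by (intro mult_left_mono sum_Suc_times_power_le) auto
  have bound: "norm (toeplitz_det k (symbol_coeff (F k) g) - toeplitz_det k (symbol_coeff f g))
      \<le> exp B * (exp (Q * ((real k)\<^sup>2 * D k)) - 1)" for k
  proof -
    have "norm (toeplitz_det k (symbol_coeff (F k) g) - toeplitz_det k (symbol_coeff f g))
        \<le> (\<Prod>i<k. 1 + \<beta> i + real k * (Q * D k)) - (\<Prod>i<k. 1 + \<beta> i)"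
      unfolding det_X[symmetric] by (rule det_perturbation[OF X X row diff])
    also have "\<dots> \<le> exp B * (exp (real k * (real k * (Q * D k))) - 1)"
      using \<beta> Q D0 sum_\<beta> by (intro prod_add_const_minus_le) auto
    finally show ?thesis by (simp add: power2_eq_square mult_ac)
  qed
  have "(\<lambda>k. exp B * (exp (Q * ((real k)\<^sup>2 * D k)) - 1)) \<longlonglongrightarrow> exp B * (exp (Q * 0) - 1)"
    by (rule tendsto_mult[OF tendsto_const tendsto_diff[OF tendsto_exp[OF tendsto_mult[OF tendsto_const D]] tendsto_const]])
  then have "(\<lambda>k. exp B * (exp (Q * ((real k)\<^sup>2 * D k)) - 1)) \<longlonglongrightarrow> 0" by simp
  then show ?thesis
    by (rule Lim_null_comparison[OF always_eventually[OF allI[OF bound]]])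
qed

section \<open>Evaluation of the generating functions\<close>

text \<open>A lower bound uniform in \<open>m\<close>, from
  \<open>exp (- (y / (1 - r))) \<le> 1 - y\<close> on the interval from 0 to \<open>r\<close> and
  the geometric series. It is the source of the constant in all later decay estimates.\<close>

lemma exp_le_q_fact:
  assumes r: "0 \<le> r" "r < (1 :: real)"
  shows "exp (- (1 / (1 - r)\<^sup>2)) \<le> q_fact r m"
proof -
  have step: "exp (- (y / (1 - r))) \<le> 1 - y" if y: "0 \<le> y" "y \<le> r" for y
  proof -
    have "(1 - y) * (1 + y / (1 - r)) = 1 + y * (r - y) / (1 - r)"
      using r by (simp add: field_simps)
    then have "1 \<le> (1 - y) * (1 + y / (1 - r))" using r y by simp
    also have "\<dots> \<le> (1 - y) * exp (y / (1 - r))"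
      using r y by (intro mult_left_mono) auto
    finally show ?thesis by (simp add: exp_minus field_simps)
  qed
  have "exp (- ((\<Sum>i<m. r ^ Suc i) / (1 - r))) \<le> q_fact r m"
  proof (induction m)
    case (Suc m)
    have "exp (- ((\<Sum>i<Suc m. r ^ Suc i) / (1 - r)))
        = exp (- ((\<Sum>i<m. r ^ Suc i) / (1 - r))) * exp (- (r ^ Suc m / (1 - r)))"
      by (simp add: exp_add[symmetric] add_divide_distrib)
    also have "\<dots> \<le> q_fact r m * (1 - r ^ Suc m)"
    proof (intro mult_mono Suc.IH step)
      show "r ^ Suc m \<le> r" using r power_le_one[of r m] mult_left_mono[of "r ^ m" 1 r] by simp
      show "0 \<le> q_fact r m"
        unfolding q_fact_def using r by (intro prod_nonneg) (simp add: power_le_one del: power_Suc)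
    qed (use r in auto)
    finally show ?case by (simp only: q_fact_Suc)
  qed simp
  moreover have "(\<Sum>i<m. r ^ Suc i) / (1 - r) \<le> 1 / (1 - r)\<^sup>2"
  proof -
    have "(\<Sum>i<m. r ^ Suc i) \<le> (\<Sum>i<m. r ^ i)"
      using r by (intro sum_mono) (simp add: mult_left_le_one_le)
    also have "\<dots> \<le> (\<Sum>i. r ^ i)"
      using r by (intro sum_le_suminf summable_geometric) auto
    also have "\<dots> = 1 / (1 - r)" using r by (simp add: suminf_geometric)
    finally have "(\<Sum>i<m. r ^ Suc i) / (1 - r) \<le> 1 / (1 - r) / (1 - r)"
      using r by (intro divide_right_mono) auto
    then show ?thesis by (simp only: power2_eq_square divide_divide_eq_left)
  qed
  ultimately show ?thesis
    by (meson exp_le_cancel_iff neg_le_iff_le order.trans)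
qed

section \<open>Decay of q-series coefficients and the q-exponential\<close>

lemma q_fact_neq_0:
  fixes t :: complex
  assumes "norm t < 1"
  shows "q_fact t m \<noteq> 0"
proof -
  have "t ^ Suc i \<noteq> 1" for i
  proof
    assume "t ^ Suc i = 1"
    then have "norm t ^ Suc i = 1" by (metis norm_one norm_power)
    moreover have "norm t ^ Suc i \<le> norm t"
      using assms power_le_one[of "norm t" i] mult_left_mono[of "norm t ^ i" 1 "norm t"] by simp
    ultimately show False using assms by linarith
  qed
  then show ?thesis by (simp add: q_fact_def del: power_Suc)
qed

text \<open>Since the norm of \<open>1 - t ^ Suc m\<close> is at least
  \<open>1 - norm t ^ Suc m\<close>, the coefficients are compared with
  \<open>q_fact (norm t)\<close>. The recursion is assumed as an inequality so as to cover the
  q-exponential and its inverse alike.\<close>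

lemma decay_of_q_recursion:
  fixes u :: "nat \<Rightarrow> complex"
  assumes t: "norm t < 1" and u0: "norm (u 0) \<le> 1" and R: "0 \<le> R"
    and step: "\<And>m. norm (u (Suc m) * (1 - t ^ Suc m)) \<le> R * norm (u m)"
  shows "norm (u m) \<le> exp (1 / (1 - norm t)\<^sup>2) * R ^ m"
proof -
  have nonneg: "0 \<le> q_fact (norm t) m" for m
    unfolding q_fact_def using t by (intro prod_nonneg) (simp add: power_le_one del: power_Suc)
  have "norm (u m) * q_fact (norm t) m \<le> R ^ m"
  proof (induction m)
    case (Suc m)
    have "1 - norm t ^ Suc m \<le> norm (1 - t ^ Suc m)"
      using norm_triangle_ineq2[of 1 "t ^ Suc m"] by (simp add: norm_power del: power_Suc)
    then have "norm (u (Suc m)) * (1 - norm t ^ Suc m) \<le> norm (u (Suc m) * (1 - t ^ Suc m))"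
      unfolding norm_mult by (intro mult_left_mono) auto
    also have "\<dots> \<le> R * norm (u m)" by (rule step)
    finally have "norm (u (Suc m)) * (1 - norm t ^ Suc m) * q_fact (norm t) m \<le> R * norm (u m) * q_fact (norm t) m"
      by (rule mult_right_mono[OF _ nonneg])
    then have "norm (u (Suc m)) * q_fact (norm t) (Suc m) \<le> R * norm (u m) * q_fact (norm t) m"
      by (simp only: q_fact_Suc mult_ac)
    also have "\<dots> \<le> R ^ Suc m" using mult_left_mono[OF Suc.IH R] by (simp add: mult_ac)
    finally show ?case .
  qed (use u0 in simp)
  moreover have "norm (u m) * exp (- (1 / (1 - norm t)\<^sup>2)) \<le> norm (u m) * q_fact (norm t) m"
    using t by (intro mult_left_mono exp_le_q_fact) auto
  ultimately have "norm (u m) * exp (- (1 / (1 - norm t)\<^sup>2)) \<le> R ^ m" by linarith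
  then show ?thesis by (simp add: exp_minus field_simps)
qed

text \<open>Euler's series for the infinite product of \<open>1 / (1 - x * t ^ n * z)\<close> over
  \<open>n \<ge> 0\<close>. Thus \<open>f\<close> is \<open>q_exp t t\<close> and \<open>g\<close>
  is \<open>q_exp q t\<close>.\<close>

definition q_exp :: "complex \<Rightarrow> complex \<Rightarrow> complex fps" where
  "q_exp x t = Abs_fps (\<lambda>m. x ^ m / q_fact t m)"

lemma fps_nth_q_exp_0 [simp]: "fps_nth (q_exp x t) 0 = 1"
  by (simp add: q_exp_def)

lemma inverse_q_exp_mult: "inverse (q_exp x t) * q_exp x t = 1"
  by (rule inverse_mult_eq_1) simp

lemma fps_scale_mult: "fps_scale c (A * B) = fps_scale c A * fps_scale c B"
proof (rule fps_ext)
  fix n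
  have "c ^ n * (fps_nth A i * fps_nth B (n - i)) = c ^ i * fps_nth A i * (c ^ (n - i) * fps_nth B (n - i))"
    if "i \<in> {0..n}" for i
  proof -
    have "c ^ n = c ^ i * c ^ (n - i)" using that by (simp add: power_add[symmetric])
    then show ?thesis by (simp only: mult_ac)
  qed
  then show "fps_nth (fps_scale c (A * B)) n = fps_nth (fps_scale c A * fps_scale c B) n"
    by (simp add: fps_mult_nth sum_distrib_left)
qed

lemma fps_scale_1 [simp]: "fps_scale c 1 = 1"
  by (simp add: fps_eq_iff)

context
  fixes x t :: complex
  assumes t: "norm t < 1"
begin

lemma q_exp_rec: "fps_nth (q_exp x t) (Suc m) * (1 - t ^ Suc m) = x * fps_nth (q_exp x t) m"
  by (rule series_rec_of_q_fact) (use q_fact_neq_0[OF t] in \<open>auto simp: q_exp_def\<close>)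

text \<open>Splits Euler's product after \<open>n\<close> factors: the tail is the same series at
  \<open>t ^ n * z\<close>, and is divided out.\<close>

lemma q_exp_eq_prod:
  "(\<Prod>s<n. geometric_fps (x * t ^ s)) = q_exp x t * fps_scale (t ^ n) (inverse (q_exp x t))"
proof -
  let ?F = "\<Prod>s<n. geometric_fps (x * t ^ s)"
  have "fps_scale (t ^ n) (q_exp x t) * fps_scale (t ^ n) (inverse (q_exp x t)) = 1"
    by (simp only: fps_scale_mult[symmetric] inverse_q_exp_mult mult.commute[of "q_exp x t"] fps_scale_1)
  then have "?F = (?F * fps_scale (t ^ n) (q_exp x t)) * fps_scale (t ^ n) (inverse (q_exp x t))"
    by (simp only: mult.assoc mult_1_right)
  also have "?F * fps_scale (t ^ n) (q_exp x t) = q_exp x t"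
    by (rule eq_prod_geometric_times_scale[symmetric]) (rule q_exp_rec)
  finally show ?thesis .
qed

text \<open>For the inverse series \<open>p\<close> the case \<open>n = 1\<close> of the splitting
  reads \<open>p z = (1 - x * z) * p (t * z)\<close>; the recursion compares coefficients.\<close>

lemma inverse_q_exp_rec:
  "fps_nth (inverse (q_exp x t)) (Suc m) * (1 - t ^ Suc m) = - (x * t ^ m) * fps_nth (inverse (q_exp x t)) m"
proof -
  let ?p = "inverse (q_exp x t)"
  have geom: "geometric_fps x = q_exp x t * fps_scale t ?p"
    using q_exp_eq_prod[of 1] by simp
  have "(1 - fps_const x * fps_X) * fps_scale t ?p
      = (?p * q_exp x t) * ((1 - fps_const x * fps_X) * fps_scale t ?p)"
    by (simp only: inverse_q_exp_mult mult_1_left)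
  also have "\<dots> = ?p * ((1 - fps_const x * fps_X) * (q_exp x t * fps_scale t ?p))"
    by (simp only: mult_ac)
  also have "\<dots> = ?p"
    by (simp only: geom[symmetric] linear_times_geometric_fps mult_1_right)
  finally have "(1 - fps_const x * fps_X) * fps_scale t ?p = ?p" .
  then have "fps_nth ((1 - fps_const x * fps_X) * fps_scale t ?p) (Suc m) = fps_nth ?p (Suc m)"
    by (simp only:)
  then have "t ^ Suc m * fps_nth ?p (Suc m) - x * (t ^ m * fps_nth ?p m) = fps_nth ?p (Suc m)"
    by (simp add: left_diff_distrib mult.assoc)
  then show ?thesis by (simp add: algebra_simps)
qed

lemma norm_q_exp_le: "norm (fps_nth (q_exp x t) m) \<le> exp (1 / (1 - norm t)\<^sup>2) * norm x ^ m"
  by (rule decay_of_q_recursion[OF t]) (simp_all only: q_exp_rec norm_mult fps_nth_q_exp_0, simp_all)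

lemma norm_inverse_q_exp_le:
  "norm (fps_nth (inverse (q_exp x t)) m) \<le> exp (1 / (1 - norm t)\<^sup>2) * norm x ^ m"
proof (rule decay_of_q_recursion[OF t])
  fix m
  have "norm t ^ m \<le> 1" using t by (simp add: power_le_one)
  then show "norm (fps_nth (inverse (q_exp x t)) (Suc m) * (1 - t ^ Suc m))
      \<le> norm x * norm (fps_nth (inverse (q_exp x t)) m)"
    unfolding inverse_q_exp_rec
    by (simp add: norm_mult norm_power mult_left_le mult.assoc mult_left_mono mult_left_le_one_le)
qed simp_all

text \<open>In the product of \<open>q_exp x t\<close> with its scaled inverse, the term
  \<open>i = m\<close> is the coefficient of \<open>q_exp x t\<close> itself, and every other term
  carries a factor \<open>t ^ n\<close>. The bound is uniform in \<open>m\<close>.\<close>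

lemma norm_prod_geometric_minus_q_exp_le:
  assumes x: "norm x < 1"
  shows "norm (fps_nth (\<Prod>s<n. geometric_fps (x * t ^ s)) m - fps_nth (q_exp x t) m)
     \<le> (exp (1 / (1 - norm t)\<^sup>2))\<^sup>2 / (1 - norm x) * norm t ^ n"
proof -
  define C where "C = exp (1 / (1 - norm t)\<^sup>2)"
  let ?f = "q_exp x t" and ?p = "inverse (q_exp x t)"
  have f: "norm (fps_nth ?f i) \<le> C * norm x ^ i" and p: "norm (fps_nth ?p i) \<le> C" for i
  proof -
    show "norm (fps_nth ?f i) \<le> C * norm x ^ i" unfolding C_def by (rule norm_q_exp_le)
    have "norm (fps_nth ?p i) \<le> C * norm x ^ i" unfolding C_def by (rule norm_inverse_q_exp_le)
    also have "\<dots> \<le> C * 1" using x by (intro mult_left_mono power_le_one) (auto simp: C_def)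
    finally show "norm (fps_nth ?p i) \<le> C" by simp
  qed
  have "fps_nth (\<Prod>s<n. geometric_fps (x * t ^ s)) m
      = (\<Sum>i\<le>m. fps_nth ?f i * ((t ^ n) ^ (m - i) * fps_nth ?p (m - i)))"
    unfolding q_exp_eq_prod by (simp add: fps_mult_nth atLeast0AtMost)
  also have "\<dots> = (\<Sum>i<m. fps_nth ?f i * ((t ^ n) ^ (m - i) * fps_nth ?p (m - i))) + fps_nth ?f m"
    by (simp add: lessThan_Suc_atMost[symmetric])
  finally have "norm (fps_nth (\<Prod>s<n. geometric_fps (x * t ^ s)) m - fps_nth ?f m)
      = norm (\<Sum>i<m. fps_nth ?f i * ((t ^ n) ^ (m - i) * fps_nth ?p (m - i)))" by simp
  also have "\<dots> \<le> (\<Sum>i<m. (C * norm x ^ i) * (norm t ^ n * C))"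
  proof (rule sum_norm_le)
    fix i assume "i \<in> {..<m}"
    then obtain d where d: "m - i = Suc d" by (metis Suc_diff_Suc lessThan_iff)
    have "norm ((t ^ n) ^ (m - i)) \<le> norm t ^ n * 1"
      unfolding d power_Suc norm_mult norm_power using t
      by (intro mult_left_mono power_le_one) auto
    then show "norm (fps_nth ?f i * ((t ^ n) ^ (m - i) * fps_nth ?p (m - i))) \<le> (C * norm x ^ i) * (norm t ^ n * C)"
      unfolding norm_mult by (intro mult_mono f p) (auto simp: C_def)
  qed
  also have "\<dots> = C\<^sup>2 * norm t ^ n * (\<Sum>i<m. norm x ^ i)"
    by (simp add: sum_distrib_left power2_eq_square mult_ac)
  also have "\<dots> \<le> C\<^sup>2 * norm t ^ n * (\<Sum>i. norm x ^ i)"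
    using x by (intro mult_left_mono sum_le_suminf summable_geometric) auto
  finally show ?thesis using x by (simp add: C_def suminf_geometric mult_ac)
qed

end

section \<open>Absolute convergence and summation over partitions\<close>

lemma fps_conv_radius_ge_1:
  fixes A :: "complex fps"
  assumes "\<And>n. norm (fps_nth A n) \<le> 1"
  shows "1 \<le> fps_conv_radius A"
  unfolding fps_conv_radius_def
proof (rule conv_radius_geI_ex')
  fix r :: real assume r: "0 < r" "ereal r < 1"
  have "norm (fps_nth A n * of_real r ^ n) \<le> r ^ n" for n
    using r assms[of n] by (simp add: norm_mult norm_power mult_left_le_one_le)
  moreover have "summable (\<lambda>n. r ^ n)" using r by (intro summable_geometric) auto
  ultimately show "summable (\<lambda>n. fps_nth A n * of_real r ^ n)"
    by (rule summable_comparison_test'[where g = "\<lambda>n. r ^ n" and N = 0, rotated])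
qed

lemma bounded_part_series_step:
  "bounded_part_series (Suc k) * (1 - fps_X ^ (2 * Suc k)) = (bounded_part_series k :: 'a :: comm_ring_1 fps)"
  using bounded_part_series_Suc[of k, where 'a = 'a] by (simp add: algebra_simps)

text \<open>Each new part size multiplies by the geometric series \<open>G\<close> with coefficients
  0 and 1, and a product converges wherever both factors do.\<close>

lemma fps_conv_radius_bounded_part_series:
  "1 \<le> fps_conv_radius (bounded_part_series k :: complex fps)"
proof (induction k)
  case 0
  have "bounded_part_series 0 = (1 :: complex fps)"
    using bounded_part_series_times_q_fact[of 0, where 'a = complex] by simp
  then show ?case by simp
next
  case (Suc k)
  define j where "j = 2 * Suc k"
  have j: "0 < j" by (simp add: j_def)
  define G :: "complex fps" where "G = Abs_fps (\<lambda>n. if j dvd n then 1 else 0)"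
  have "(1 - fps_X ^ j) * G = 1"
  proof (rule fps_ext)
    fix n
    show "fps_nth ((1 - fps_X ^ j) * G) n = fps_nth 1 n"
    proof (cases "n < j")
      case True
      then have "j dvd n \<longleftrightarrow> n = 0" by (auto dest: dvd_imp_le)
      then show ?thesis using True by (simp add: left_diff_distrib fps_X_power_mult_nth G_def)
    next
      case False
      then have "j dvd n - j \<longleftrightarrow> j dvd n" by (simp add: dvd_minus_self)
      then show ?thesis using False j by (simp add: left_diff_distrib fps_X_power_mult_nth G_def)
    qed
  qed
  then have "bounded_part_series (Suc k) = bounded_part_series k * G"
    unfolding bounded_part_series_step[of k, symmetric] by (simp add: mult.assoc j_def)
  moreover have "1 \<le> fps_conv_radius G"
    by (rule fps_conv_radius_ge_1) (simp add: G_def)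
  ultimately show ?case
    using fps_conv_radius_mult[of "bounded_part_series k" G] Suc.IH by (metis min.bounded_iff order.trans)
qed

lemma less_fps_conv_radius_bounded_part_series:
  assumes "norm z < 1"
  shows "ereal (norm z) < fps_conv_radius (bounded_part_series k :: complex fps)"
proof -
  have "ereal (norm z) < 1" using assms by (simp add: one_ereal_def)
  then show ?thesis using fps_conv_radius_bounded_part_series[of k] by (rule less_le_trans)
qed

lemma eval_bounded_part_series:
  fixes z :: complex
  assumes z: "norm z < 1"
  shows "eval_fps (bounded_part_series k) z = 1 / q_fact (z\<^sup>2) k"
proof -
  have rad: "ereal (norm z) < fps_conv_radius (bounded_part_series k :: complex fps)" for k
    by (rule less_fps_conv_radius_bounded_part_series[OF z])
  have "eval_fps (bounded_part_series k) z * q_fact (z\<^sup>2) k = 1"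
  proof (induction k)
    case 0
    have "bounded_part_series 0 = (1 :: complex fps)"
      using bounded_part_series_times_q_fact[of 0, where 'a = complex] by simp
    then show ?case by simp
  next
    case (Suc k)
    have rad_poly: "fps_conv_radius (1 - fps_X ^ j :: complex fps) = \<infinity>" for j
      using fps_conv_radius_diff[of "1 :: complex fps" "fps_X ^ j"] by simp
    have "eval_fps (bounded_part_series (Suc k) * (1 - fps_X ^ (2 * Suc k))) z
        = eval_fps (bounded_part_series (Suc k)) z * eval_fps (1 - fps_X ^ (2 * Suc k)) z"
      by (rule eval_fps_mult[OF rad]) (simp only: rad_poly, simp)
    also have "eval_fps (1 - fps_X ^ (2 * Suc k)) z = 1 - (z\<^sup>2) ^ Suc k"
    proof -
      have "eval_fps (1 - fps_X ^ j) z = 1 - z ^ j" for j by (subst eval_fps_diff) simp_all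
      from this[of "2 * Suc k"] show ?thesis unfolding power_mult[of z 2] .
    qed
    finally have "eval_fps (bounded_part_series k) z
        = eval_fps (bounded_part_series (Suc k)) z * (1 - (z\<^sup>2) ^ Suc k)"
      by (simp only: bounded_part_series_step)
    then show ?case using Suc.IH by (simp add: q_fact_Suc mult_ac)
  qed
  moreover have "q_fact (z\<^sup>2) k \<noteq> 0"
    by (rule q_fact_neq_0) (use z in \<open>simp add: norm_power power_less_one_iff abs_square_less_1\<close>)
  ultimately show ?thesis by (simp add: field_simps)
qed

definition rank_term :: "int \<Rightarrow> nat \<Rightarrow> nat \<Rightarrow> complex" where
  "rank_term m l n = fps_nth (max_part_series (m + int l) * distinct_series l) n"

text \<open>The coefficients are counts, so the norm of a term at \<open>z\<close> is the term at
  \<open>norm z\<close>; absolute convergence reduces to convergence at a nonnegative real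
  point.\<close>

lemma norm_rank_term: "norm (rank_term m l n * z ^ n) = Re (rank_term m l n * of_real (norm z) ^ n)"
proof -
  obtain c :: nat where "rank_term m l n = of_nat c"
  proof
    show "rank_term m l n = of_nat (\<Sum>i\<le>n. card {p. 0 \<notin># p \<and> int (max_part p) = m + int l \<and> 2 * sum_mset p = i}
        * card {U. finite U \<and> 0 \<notin> U \<and> set_alternating_sum U = int l \<and> \<Sum>U = n - i})"
      by (simp add: rank_term_def fps_mult_nth max_part_series_def distinct_series_def atLeast0AtMost)
  qed
  moreover have "(of_nat c * of_real (norm z) ^ n :: complex) = of_real (real c * norm z ^ n)" by simp
  ultimately show ?thesis by (simp only: norm_mult norm_power norm_of_nat Re_complex_of_real)
qed

lemma rank_term_sums:
  assumes z: "norm z < 1"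
  shows "(\<lambda>n. rank_term m l n * z ^ n)
      sums (int_coeff (q_exp (z\<^sup>2) (z\<^sup>2)) (m + int l) * fps_nth (q_exp z (z\<^sup>2)) l)"
proof (cases "m + int l < 0")
  case False
  define j where "j = nat (m + int l)"
  have j: "m + int l = int j" using False by (simp add: j_def)
  let ?B = "bounded_part_series :: nat \<Rightarrow> complex fps"
  have rad: "ereal (norm z) < fps_conv_radius (?B k)" for k
    by (rule less_fps_conv_radius_bounded_part_series[OF z])
  have rad2: "ereal (norm z) < fps_conv_radius (?B j * ?B l)"
    using rad[of j] rad[of l] fps_conv_radius_mult[of "?B j" "?B l"] by (meson less_le_trans min_less_iff_conj)
  have rad3: "ereal (norm z) < fps_conv_radius (fps_X ^ (2 * j + l) * (?B j * ?B l))"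
    using rad2 fps_conv_radius_mult[of "fps_X ^ (2 * j + l)" "?B j * ?B l"] by (simp add: less_le_trans)
  have T: "max_part_series (m + int l) * distinct_series l = fps_X ^ (2 * j + l) * (?B j * ?B l)"
    unfolding j max_part_series_eq distinct_series_eq_bounded by (simp add: power_add mult_ac)
  have "eval_fps (fps_X ^ (2 * j + l) * (?B j * ?B l)) z
      = z ^ (2 * j + l) * (1 / q_fact (z\<^sup>2) j * (1 / q_fact (z\<^sup>2) l))"
    using rad rad2 by (simp add: eval_fps_mult eval_bounded_part_series[OF z])
  also have "\<dots> = int_coeff (q_exp (z\<^sup>2) (z\<^sup>2)) (m + int l) * fps_nth (q_exp z (z\<^sup>2)) l"
    by (simp add: j int_coeff_def q_exp_def power_add power_mult)
  finally show ?thesis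
    using sums_eval_fps[OF rad3] by (simp add: rank_term_def T)
qed (simp add: rank_term_def max_part_series_neg int_coeff_def)

lemma norm_square_less_1: "norm (z :: complex) < 1 \<Longrightarrow> norm (z\<^sup>2) < 1"
  by (simp add: norm_power abs_square_less_1)

lemma summable_rank_symbol:
  fixes z :: complex
  assumes z: "norm z < 1"
  shows "summable (\<lambda>l. norm (int_coeff (q_exp (z\<^sup>2) (z\<^sup>2)) (m + int l) * fps_nth (q_exp z (z\<^sup>2)) l))"
proof -
  define C where "C = exp (1 / (1 - norm (z\<^sup>2))\<^sup>2)"
  have z2: "norm (z\<^sup>2) < 1" by (rule norm_square_less_1[OF z])
  have "norm (int_coeff (q_exp (z\<^sup>2) (z\<^sup>2)) (m + int l) * fps_nth (q_exp z (z\<^sup>2)) l) \<le> C * (C * norm z ^ l)" for l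
    unfolding norm_mult
  proof (intro mult_mono norm_int_coeff_le)
    fix i
    have "norm (fps_nth (q_exp (z\<^sup>2) (z\<^sup>2)) i) \<le> C * norm (z\<^sup>2) ^ i"
      unfolding C_def by (rule norm_q_exp_le[OF z2])
    also have "\<dots> \<le> C * 1" using z2 by (intro mult_left_mono power_le_one) (auto simp: C_def)
    finally show "norm (fps_nth (q_exp (z\<^sup>2) (z\<^sup>2)) i) \<le> C" by simp
    show "norm (fps_nth (q_exp z (z\<^sup>2)) l) \<le> C * norm z ^ l"
      unfolding C_def by (rule norm_q_exp_le[OF z2])
  qed (auto simp: C_def)
  moreover have "summable (\<lambda>l. C * (C * norm z ^ l))"
    using z by (intro summable_mult summable_geometric) auto
  ultimately show ?thesis
    by (intro summable_norm_comparison_test[of _ "\<lambda>l. C * (C * norm z ^ l)"]) auto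
qed

text \<open>An exchange of summation in the double family indexed by \<open>l\<close> and the degree
  \<open>n\<close>. Summing over \<open>n\<close> first gives the terms of the symbol coefficient,
  summing over \<open>l\<close> first gives finite sums, the coefficients of the rank series.
  Absolute summability is checked at \<open>norm z\<close>.\<close>

lemma rank_series_sums:
  fixes z :: complex
  assumes z: "norm z < 1"
  shows "((\<lambda>n. fps_nth (rank_series m) n * z ^ n) has_sum symbol_coeff (q_exp (z\<^sup>2) (z\<^sup>2)) (q_exp z (z\<^sup>2)) m) UNIV"
    and "(\<lambda>n. norm (fps_nth (rank_series m) n * z ^ n)) summable_on UNIV"
proof -
  define f where "f = (\<lambda>(l, n). rank_term m l n * z ^ n)"
  define \<rho> where "\<rho> = complex_of_real (norm z)"
  have \<rho>: "norm \<rho> < 1" using z by (simp add: \<rho>_def)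
  define A where "A z l = int_coeff (q_exp (z\<^sup>2) (z\<^sup>2)) (m + int l) * fps_nth (q_exp z (z\<^sup>2)) l" for z l
  have norm_sums: "(\<lambda>n. norm (rank_term m l n * z ^ n)) sums Re (A \<rho> l)" for l
    unfolding norm_rank_term \<rho>_def[symmetric] A_def by (rule sums_Re[OF rank_term_sums[OF \<rho>]])
  have f1: "((\<lambda>n. norm (f (l, n))) has_sum Re (A \<rho> l)) UNIV" for l
    using norm_sums[of l] by (intro sums_nonneg_imp_has_sum) (auto simp: f_def)
  have f2: "((\<lambda>n. f (l, n)) has_sum A z l) UNIV" for l
    using norm_sums[of l] rank_term_sums[OF z, of m l]
    by (intro norm_summable_imp_has_sum) (auto simp: f_def A_def sums_iff)
  have "(\<lambda>l. Re (A \<rho> l)) summable_on UNIV"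
  proof (rule norm_summable_imp_summable_on)
    show "summable (\<lambda>l. norm (Re (A \<rho> l)))"
      using summable_rank_symbol[OF \<rho>, of m]
      by (rule summable_comparison_test'[where N = 0]) (simp only: A_def real_norm_def abs_idempotent abs_Re_le_cmod)
  qed
  then have fs: "(\<lambda>x. norm (f x)) summable_on (UNIV \<times> UNIV)"
    using f1 by (intro summable_on_SigmaI) auto
  have sA: "(A z has_sum symbol_coeff (q_exp (z\<^sup>2) (z\<^sup>2)) (q_exp z (z\<^sup>2)) m) UNIV"
    using summable_rank_symbol[OF z, of m] unfolding A_def symbol_coeff_def
    by (intro norm_summable_imp_has_sum summable_sums) (auto intro: summable_norm_cancel)
  have swap: "((\<lambda>(n, l). f (l, n)) has_sum symbol_coeff (q_exp (z\<^sup>2) (z\<^sup>2)) (q_exp z (z\<^sup>2)) m) (UNIV \<times> UNIV)"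
    using has_sum_SigmaI[OF f2 sA abs_summable_summable[OF fs]] has_sum_swap by blast
  have col: "((\<lambda>l. f (l, n)) has_sum fps_nth (rank_series m) n * z ^ n) UNIV" for n
  proof (rule has_sum_finite_neutralI[of "{..n}"])
    show "f (l, n) = 0" if "l \<in> UNIV - {..n}" for l
    proof -
      have "n < l" using that by auto
      then have "eq_upto n (fps_X ^ l * (max_part_series (m + int l) * bounded_part_series l)) (0 :: complex fps)"
        by (rule eq_upto_X_power_mult)
      then show ?thesis
        by (simp add: f_def rank_term_def eq_upto_def distinct_series_eq_bounded mult.left_commute)
    qed
    show "fps_nth (rank_series m) n * z ^ n = (\<Sum>l\<le>n. f (l, n))"
      by (simp add: f_def rank_term_def fps_nth_rank_series sum_distrib_right)
  qed auto
  show "((\<lambda>n. fps_nth (rank_series m) n * z ^ n) has_sum symbol_coeff (q_exp (z\<^sup>2) (z\<^sup>2)) (q_exp z (z\<^sup>2)) m) UNIV"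
    using swap col by (intro has_sum_SigmaD[OF swap]) auto
  then have "(\<lambda>n. fps_nth (rank_series m) n * z ^ n) summable_on UNIV"
    by (auto simp: summable_on_def)
  then show "(\<lambda>n. norm (fps_nth (rank_series m) n * z ^ n)) summable_on UNIV"
    by (simp add: summable_on_iff_abs_summable_on_complex)
qed

text \<open>Grouping by size: each group is finite and all its terms are equal, so norms are lost
  neither within a group nor in passing from the power series to the partitions.\<close>

lemma has_sum_rank_gf_value:
  fixes q :: complex
  assumes q: "norm q < 1"
  shows "((\<lambda>p. q ^ sum_mset p) has_sum symbol_coeff (q_exp (q\<^sup>2) (q\<^sup>2)) (q_exp q (q\<^sup>2)) m) (partitions_of_rank m)"
proof -
  define P where "P n = {p \<in> partitions_of_rank m. sum_mset p = n}" for n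
  have fin: "finite (P n)" for n unfolding P_def by (rule finite_partitions_of_rank)
  have coeff: "fps_nth (rank_series m :: complex fps) n = of_nat (card (P n))" for n
    by (simp add: rank_series_def P_def)
  have col: "((\<lambda>p. q ^ sum_mset p) has_sum fps_nth (rank_series m) n * q ^ n) (P n)" for n
    by (rule has_sum_finiteI[OF fin]) (simp add: coeff P_def)
  have col_norm: "((\<lambda>p. norm (q ^ sum_mset p)) has_sum norm (fps_nth (rank_series m) n * q ^ n)) (P n)" for n
    by (rule has_sum_finiteI[OF fin]) (simp add: coeff P_def norm_mult norm_power)
  define f where "f = (\<lambda>(n :: nat, p :: nat multiset). q ^ sum_mset p)"
  have fs: "(\<lambda>x. norm (f x)) summable_on Sigma UNIV P"
  proof (rule summable_on_SigmaI)
    show "((\<lambda>p. norm (f (n, p))) has_sum norm (fps_nth (rank_series m) n * q ^ n)) (P n)" for n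
      using col_norm[of n] by (simp add: f_def)
  qed (use rank_series_sums(2)[OF q, of m] in auto)
  have "(f has_sum symbol_coeff (q_exp (q\<^sup>2) (q\<^sup>2)) (q_exp q (q\<^sup>2)) m) (Sigma UNIV P)"
  proof (rule has_sum_SigmaI[OF _ rank_series_sums(1)[OF q] abs_summable_summable[OF fs]])
    show "((\<lambda>p. f (n, p)) has_sum fps_nth (rank_series m) n * q ^ n) (P n)" for n
      using col[of n] by (simp add: f_def)
  qed
  then have "((\<lambda>x. q ^ sum_mset (snd x)) has_sum symbol_coeff (q_exp (q\<^sup>2) (q\<^sup>2)) (q_exp q (q\<^sup>2)) m) (Sigma UNIV P)"
    by (simp only: f_def case_prod_unfold)
  moreover have "bij_betw snd (Sigma UNIV P) (partitions_of_rank m)"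
    by (rule bij_betw_byWitness[where f' = "\<lambda>p. (sum_mset p, p)"]) (auto simp: P_def)
  ultimately show ?thesis
    using has_sum_reindex_bij_betw[of snd "Sigma UNIV P" "partitions_of_rank m" "\<lambda>p. q ^ sum_mset p"] by blast
qed

section \<open>The analytic limit\<close>

lemma tendsto_toeplitz_det:
  fixes a :: "nat \<Rightarrow> int \<Rightarrow> complex"
  assumes "\<And>m. (\<lambda>L. a L m) \<longlonglongrightarrow> b m"
  shows "(\<lambda>L. toeplitz_det k (a L)) \<longlonglongrightarrow> toeplitz_det k b"
proof -
  have det: "toeplitz_det k c = (\<Sum>\<pi> | \<pi> permutes {0..<k}. signof \<pi> * (\<Prod>i = 0..<k. c (int i - int (\<pi> i))))"
    for c :: "int \<Rightarrow> complex"
  proof -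
    have "toeplitz_det k c = (\<Sum>\<pi> | \<pi> permutes {0..<k}. signof \<pi>
        * (\<Prod>i = 0..<k. Matrix.mat k k (\<lambda>(i, j). c (int i - int j)) $$ (i, \<pi> i)))"
      unfolding toeplitz_det_def by (rule det_def') simp
    also have "\<dots> = (\<Sum>\<pi> | \<pi> permutes {0..<k}. signof \<pi> * (\<Prod>i = 0..<k. c (int i - int (\<pi> i))))"
    proof (intro sum.cong refl arg_cong2[of _ _ _ _ "(*)"] prod.cong)
      fix \<pi> i assume "\<pi> \<in> {\<pi>. \<pi> permutes {0..<k}}" "i \<in> {0..<k}"
      then have "\<pi> i < k" "i < k" using permutes_in_image[of \<pi> "{0..<k}" i] by auto
      then show "Matrix.mat k k (\<lambda>(i, j). c (int i - int j)) $$ (i, \<pi> i) = c (int i - int (\<pi> i))" by simp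
    qed
    finally show ?thesis .
  qed
  show ?thesis unfolding det by (intro tendsto_sum tendsto_mult tendsto_prod tendsto_const assms)
qed

lemma telescoping_product:
  fixes h :: "nat \<Rightarrow> 'a :: comm_ring_1"
  assumes "\<And>s. (1 - c s) * h s = h (Suc s)"
  shows "(\<Prod>s<k. h s) * (\<Prod>s<k. (1 - c s) ^ Suc s) = h k ^ k"
proof (induction k)
  case (Suc k)
  have "(\<Prod>s<Suc k. h s) * (\<Prod>s<Suc k. (1 - c s) ^ Suc s) = ((1 - c k) * h k) ^ Suc k"
    using Suc.IH by (simp add: power_mult_distrib mult_ac)
  then show ?case by (simp only: assms)
qed simp

lemma norm_power_minus_1_le:
  fixes b :: complex
  shows "norm (b ^ k - 1) \<le> exp (real k * norm (b - 1)) - 1"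
proof -
  have "norm (b ^ k - 1) \<le> (1 + norm (b - 1)) ^ k - 1"
    using norm_prod_diff_le[of "{..<k}" "\<lambda>_. b" "\<lambda>_. 1"] by simp
  also have "(1 + norm (b - 1)) ^ k \<le> exp (norm (b - 1)) ^ k"
    by (intro power_mono) auto
  finally show ?thesis by (simp add: exp_of_nat_mult)
qed

lemma convergent_prod_product_factor:
  assumes q: "norm q < 1"
  shows "convergent_prod (product_factor q)"
proof -
  define z where "z n = real (Suc n) * norm q ^ n" for n
  have sz: "z sums (1 / (1 - norm q)\<^sup>2)"
    unfolding z_def using q geometric_deriv_sums[of "norm q"] by simp
  have z0: "0 \<le> z n" for n by (simp add: z_def)
  have zB: "z n \<le> 1 / (1 - norm q)\<^sup>2" for n
    using sum_le_suminf[of z "{n}"] sz z0 by (simp add: sums_iff)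
  have le: "norm ((1 - q ^ (2 * (n + 1) + 1)) ^ (n + 1) - 1) \<le> z n * exp (1 / (1 - norm q)\<^sup>2)" for n
  proof -
    have "norm (1 - x - 1) = norm x" for x :: complex
      by (metis add_diff_cancel_left' diff_add_cancel minus_diff_eq norm_minus_cancel)
    then have "norm (1 - q ^ (2 * (n + 1) + 1) - 1) = norm q ^ (2 * (n + 1) + 1)"
      by (simp only: norm_power)
    also have "\<dots> = norm q ^ n * norm q ^ (n + 3)"
      unfolding power_add[symmetric] by (rule arg_cong[where f = "power (norm q)"]) simp
    also have "\<dots> \<le> norm q ^ n * 1" using q by (intro mult_left_mono power_le_one) auto
    finally have "norm (1 - q ^ (2 * (n + 1) + 1) - 1) \<le> norm q ^ n * 1" .
    then have "real (n + 1) * norm (1 - q ^ (2 * (n + 1) + 1) - 1) \<le> real (n + 1) * (norm q ^ n * 1)"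
      by (rule mult_left_mono) simp
    then have y: "real (n + 1) * norm (1 - q ^ (2 * (n + 1) + 1) - 1) \<le> z n"
      by (simp only: z_def Suc_eq_plus1 mult_1_right)
    have "norm ((1 - q ^ (2 * (n + 1) + 1)) ^ (n + 1) - 1) \<le> exp (real (n + 1) * norm (1 - q ^ (2 * (n + 1) + 1) - 1)) - 1"
      by (rule norm_power_minus_1_le)
    also have "\<dots> \<le> exp (z n) - 1" using y by simp
    \<comment> \<open>This is \<open>1 - z n \<le> exp (- z n)\<close> multiplied by
      \<open>exp (z n)\<close>; boundedness of \<open>z\<close> then leaves a summable
      majorant.\<close>
    also have "\<dots> \<le> z n * exp (z n)"
    proof -
      have "(1 - z n) * exp (z n) \<le> exp (- z n) * exp (z n)"
        using exp_ge_add_one_self[of "- z n"] by (intro mult_right_mono) auto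
      then show ?thesis by (simp add: exp_minus algebra_simps)
    qed
    also have "\<dots> \<le> z n * exp (1 / (1 - norm q)\<^sup>2)"
      using zB z0 by (intro mult_left_mono) auto
    finally show ?thesis .
  qed
  have "summable (\<lambda>n. z n * exp (1 / (1 - norm q)\<^sup>2))"
    using sz by (intro summable_mult2) (auto simp: sums_iff)
  then have "summable (\<lambda>n. norm ((1 - q ^ (2 * (n + 1) + 1)) ^ (n + 1) - 1))"
    using le by (intro summable_norm_comparison_test) auto
  then have "convergent_prod (\<lambda>n. (1 - q ^ (2 * (n + 1) + 1)) ^ (n + 1))"
    by (intro abs_convergent_prod_imp_convergent_prod) (simp only: abs_convergent_prod_conv_summable)
  then have "convergent_prod (\<lambda>n. inverse ((1 - q ^ (2 * (n + 1) + 1)) ^ (n + 1)))"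
    by (rule convergent_prod_inverse)
  then show ?thesis by (simp only: product_factor_def[abs_def] inverse_eq_divide)
qed

section \<open>Values of g, their telescoping product and the limit\<close>

definition q_exp_value :: "complex \<Rightarrow> complex \<Rightarrow> complex" where
  "q_exp_value q x = (\<Sum>l. fps_nth (q_exp q (q\<^sup>2)) l * x ^ l)"

context
  fixes q :: complex
  assumes q: "norm q < 1"
begin

lemma norm_q_exp_value_term_le:
  assumes "norm x \<le> 1"
  shows "norm (fps_nth (q_exp q (q\<^sup>2)) l * x ^ l) \<le> exp (1 / (1 - norm (q\<^sup>2))\<^sup>2) * norm q ^ l"
proof -
  have "norm (fps_nth (q_exp q (q\<^sup>2)) l * x ^ l) \<le> (exp (1 / (1 - norm (q\<^sup>2))\<^sup>2) * norm q ^ l) * 1"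
    unfolding norm_mult norm_power[of x]
    using assms by (intro mult_mono norm_q_exp_le norm_square_less_1 q power_le_one) auto
  then show ?thesis by simp
qed

lemma summable_q_exp_value:
  assumes "norm x \<le> 1"
  shows "summable (\<lambda>l. fps_nth (q_exp q (q\<^sup>2)) l * x ^ l)"
proof (rule summable_comparison_test'[where N = 0])
  show "summable (\<lambda>l. exp (1 / (1 - norm (q\<^sup>2))\<^sup>2) * norm q ^ l)"
    using q by (intro summable_mult summable_geometric) auto
qed (rule norm_q_exp_value_term_le[OF assms])

lemma tendsto_q_exp_value:
  assumes "norm x \<le> 1"
  shows "(\<lambda>L. \<Sum>l\<le>L. fps_nth (q_exp q (q\<^sup>2)) l * x ^ l) \<longlonglongrightarrow> q_exp_value q x"
  unfolding q_exp_value_def by (rule summable_LIMSEQ'[OF summable_q_exp_value[OF assms]])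

lemma q_exp_value_functional_equation:
  assumes x: "norm x \<le> 1"
  shows "(1 - q * x) * q_exp_value q x = q_exp_value q (q\<^sup>2 * x)"
proof (rule LIMSEQ_unique)
  let ?g = "fps_nth (q_exp q (q\<^sup>2))"
  show "(\<lambda>L. (1 - q * x) * (\<Sum>l\<le>L. ?g l * x ^ l)) \<longlonglongrightarrow> (1 - q * x) * q_exp_value q x"
    by (intro tendsto_mult tendsto_const tendsto_q_exp_value x)
  have "norm (q\<^sup>2 * x) \<le> 1 * 1"
    unfolding norm_mult using x norm_square_less_1[OF q] by (intro mult_mono) auto
  then have 1: "(\<lambda>L. \<Sum>l\<le>L. ?g l * (q\<^sup>2 * x) ^ l) \<longlonglongrightarrow> q_exp_value q (q\<^sup>2 * x)"
    by (intro tendsto_q_exp_value) simp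
  have 2: "(\<lambda>L. q * x * (?g L * x ^ L)) \<longlonglongrightarrow> q * x * 0"
    by (intro tendsto_mult tendsto_const summable_LIMSEQ_zero summable_q_exp_value x)
  have "(\<lambda>L. (1 - q * x) * (\<Sum>l\<le>L. ?g l * x ^ l)) = (\<lambda>L. (\<Sum>l\<le>L. ?g l * (q\<^sup>2 * x) ^ l) - q * x * (?g L * x ^ L))"
    using truncated_functional_equation[of ?g "q\<^sup>2" q x, OF q_exp_rec[OF norm_square_less_1[OF q]]]
    by (simp add: fun_eq_iff mult_ac)
  then show "(\<lambda>L. (1 - q * x) * (\<Sum>l\<le>L. ?g l * x ^ l)) \<longlonglongrightarrow> q_exp_value q (q\<^sup>2 * x)"
    using tendsto_diff[OF 1 2] by simp
qed

lemma norm_q_exp_value_minus_1_le: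
  assumes x: "norm x \<le> 1"
  shows "norm (q_exp_value q x - 1) \<le> exp (1 / (1 - norm (q\<^sup>2))\<^sup>2) / (1 - norm q) * norm x"
proof -
  let ?g = "fps_nth (q_exp q (q\<^sup>2))" and ?C = "exp (1 / (1 - norm (q\<^sup>2))\<^sup>2)"
  have "q_exp_value q x - 1 = (\<Sum>l. ?g (Suc l) * x ^ Suc l)"
    unfolding q_exp_value_def by (subst suminf_split_head[OF summable_q_exp_value[OF x]]) simp
  also have "norm \<dots> \<le> (\<Sum>l. ?C * norm x * norm q ^ l)"
  proof (rule norm_suminf_le)
    fix l
    have "norm (?g (Suc l) * x ^ Suc l) = norm (?g (Suc l)) * (norm x * norm x ^ l)"
      by (simp add: norm_mult norm_power)
    also have "\<dots> \<le> (?C * norm q ^ Suc l) * (norm x * 1)"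
      using x by (intro mult_mono norm_q_exp_le norm_square_less_1 q power_le_one) auto
    also have "\<dots> \<le> (?C * norm q ^ l) * (norm x * 1)"
      using q by (intro mult_right_mono mult_left_mono power_decreasing) auto
    finally show "norm (?g (Suc l) * x ^ Suc l) \<le> ?C * norm x * norm q ^ l" by (simp add: mult_ac)
  qed (use q in \<open>intro summable_mult summable_geometric, auto\<close>)
  also have "\<dots> = ?C / (1 - norm q) * norm x"
    using q by (simp add: suminf_mult suminf_geometric summable_geometric)
  finally show ?thesis .
qed

text \<open>The determinant formula covers finite sums over \<open>l\<close>; for fixed
  \<open>k\<close> both sides are continuous in the entries, so the partial sums may be taken to
  their limit. Distinctness of the nodes rests on \<open>q \<noteq> 0\<close>.\<close>

lemma toeplitz_det_truncated_symbol:
  assumes q0: "q \<noteq> 0"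
  shows "toeplitz_det k (symbol_coeff (\<Prod>s<k. geometric_fps (q\<^sup>2 * (q\<^sup>2) ^ s)) (q_exp q (q\<^sup>2)))
      = (\<Prod>s<k. q_exp_value q ((q\<^sup>2) ^ Suc s))"
proof (rule LIMSEQ_unique)
  define t where "t = q\<^sup>2"
  have t: "norm t < 1" unfolding t_def by (rule norm_square_less_1[OF q])
  define C where "C = exp (1 / (1 - norm t)\<^sup>2)"
  define F where "F = (\<Prod>s<k. geometric_fps (t * t ^ s))"
  have F: "norm (fps_nth F m) \<le> C + C\<^sup>2 / (1 - norm t) * norm t ^ k" for m
  proof -
    have "norm (fps_nth F m - fps_nth (q_exp t t) m) \<le> C\<^sup>2 / (1 - norm t) * norm t ^ k"
      unfolding F_def C_def by (rule norm_prod_geometric_minus_q_exp_le[OF t t])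
    moreover have "norm (fps_nth (q_exp t t) m) \<le> C * norm t ^ m"
      unfolding C_def by (rule norm_q_exp_le[OF t])
    moreover have "C * norm t ^ m \<le> C * 1"
      using t by (intro mult_left_mono power_le_one) (auto simp: C_def)
    ultimately show ?thesis
      using norm_triangle_sub[of "fps_nth F m" "fps_nth (q_exp t t) m"] by linarith
  qed
  have g: "norm (fps_nth (q_exp q t) m) \<le> C * norm q ^ m" for m
    unfolding C_def by (rule norm_q_exp_le[OF t])
  have "(\<lambda>L. toeplitz_det k (\<lambda>m. \<Sum>l\<le>L. int_coeff F (m + int l) * fps_nth (q_exp q t) l))
      \<longlonglongrightarrow> toeplitz_det k (symbol_coeff F (q_exp q t))"
    unfolding symbol_coeff_def
    by (intro tendsto_toeplitz_det summable_LIMSEQ' summable_symbol_coeff(1)[OF F g]) (use q in auto)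
  moreover have "inj_on (\<lambda>s. t * t ^ s) {..<k}"
  proof (rule inj_onI)
    fix s s' assume "t * t ^ s = t * t ^ s'"
    then have eq: "norm t ^ s = norm t ^ s'" using q0 by (simp add: t_def norm_power[symmetric])
    have pos: "0 < norm t" using q0 by (simp add: t_def)
    show "s = s'"
    proof (rule ccontr)
      assume "s \<noteq> s'"
      then show False
        using power_strict_decreasing[OF _ pos t, of s s'] power_strict_decreasing[OF _ pos t, of s' s] eq
        by (cases s s' rule: linorder_cases) auto
    qed
  qed
  ultimately show "(\<lambda>L. \<Prod>s<k. \<Sum>l\<le>L. fps_nth (q_exp q (q\<^sup>2)) l * ((q\<^sup>2) ^ Suc s) ^ l)
      \<longlonglongrightarrow> toeplitz_det k (symbol_coeff (\<Prod>s<k. geometric_fps (q\<^sup>2 * (q\<^sup>2) ^ s)) (q_exp q (q\<^sup>2)))"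
    unfolding F_def t_def by (subst (asm) toeplitz_det_rational_symbol) simp_all
  show "(\<lambda>L. \<Prod>s<k. \<Sum>l\<le>L. fps_nth (q_exp q (q\<^sup>2)) l * ((q\<^sup>2) ^ Suc s) ^ l)
      \<longlonglongrightarrow> (\<Prod>s<k. q_exp_value q ((q\<^sup>2) ^ Suc s))"
  proof (intro tendsto_prod tendsto_q_exp_value)
    fix s
    show "norm ((q\<^sup>2) ^ Suc s) \<le> 1"
      unfolding norm_power[of "q\<^sup>2"] using norm_square_less_1[OF q] by (intro power_le_one) auto
  qed
qed

lemma prod_q_exp_value:
  "(\<Prod>s<k. q_exp_value q ((q\<^sup>2) ^ Suc s))
     = (\<Prod>n<k. product_factor q n) * q_exp_value q ((q\<^sup>2) ^ Suc k) ^ k"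
proof -
  let ?c = "\<lambda>s. q ^ (2 * (s + 1) + 1)"
  have norm_le: "norm ((q\<^sup>2) ^ s) \<le> 1" for s
    unfolding norm_power[of "q\<^sup>2"] using norm_square_less_1[OF q] by (intro power_le_one) auto
  have step: "(1 - ?c s) * q_exp_value q ((q\<^sup>2) ^ Suc s) = q_exp_value q ((q\<^sup>2) ^ Suc (Suc s))" for s
  proof -
    have "?c s = q * q ^ (2 * Suc s)" by simp
    then have "?c s = q * (q\<^sup>2) ^ Suc s" by (simp only: power_mult)
    then show ?thesis
      using q_exp_value_functional_equation[OF norm_le[of "Suc s"]]
      by (simp only: power_Suc[of "q\<^sup>2" "Suc s"])
  qed
  have "norm (?c s) < 1" for s
    unfolding norm_power using q power_le_one[of "norm q" "2 * (s + 1)"]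
      mult_left_mono[of "norm q ^ (2 * (s + 1))" 1 "norm q"] by simp
  then have "1 - ?c s \<noteq> 0" for s by (metis eq_iff_diff_eq_0 norm_one order_less_irrefl)
  then have "(1 - ?c s) ^ Suc s * product_factor q s = 1" for s
    by (simp add: product_factor_def del: power_Suc)
  then have "(\<Prod>s<k. (1 - ?c s) ^ Suc s) * (\<Prod>n<k. product_factor q n) = 1"
    by (simp add: prod.distrib[symmetric] del: power_Suc)
  then have "(\<Prod>s<k. q_exp_value q ((q\<^sup>2) ^ Suc s))
      = ((\<Prod>s<k. q_exp_value q ((q\<^sup>2) ^ Suc s)) * (\<Prod>s<k. (1 - ?c s) ^ Suc s)) * (\<Prod>n<k. product_factor q n)"
    by (simp only: mult.assoc mult_1_right)
  also have "(\<Prod>s<k. q_exp_value q ((q\<^sup>2) ^ Suc s)) * (\<Prod>s<k. (1 - ?c s) ^ Suc s)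
      = q_exp_value q ((q\<^sup>2) ^ Suc k) ^ k"
    by (rule telescoping_product[where h = "\<lambda>s. q_exp_value q ((q\<^sup>2) ^ Suc s)" and c = ?c]) (rule step)
  finally show ?thesis by (simp only: mult.commute)
qed

text \<open>The base differs from 1 by at most a constant times \<open>norm t ^ k\<close>, which
  tends to 0 even after multiplication by the exponent \<open>k\<close>.\<close>

lemma tendsto_q_exp_value_power: "(\<lambda>k. q_exp_value q ((q\<^sup>2) ^ Suc k) ^ k) \<longlonglongrightarrow> 1"
proof -
  define t where "t = q\<^sup>2"
  have t: "norm t < 1" unfolding t_def by (rule norm_square_less_1[OF q])
  define K where "K = exp (1 / (1 - norm t)\<^sup>2) / (1 - norm q)"
  have K: "0 \<le> K" using q by (simp add: K_def)
  have le: "norm (q_exp_value q (t ^ Suc k) ^ k - 1) \<le> exp (K * (real k * norm t ^ k)) - 1" for k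
  proof -
    have "norm (t ^ Suc k) \<le> norm t ^ k"
      unfolding norm_power using t by (intro power_decreasing) auto
    also have "\<dots> \<le> 1" using t by (intro power_le_one) auto
    finally have "norm (q_exp_value q (t ^ Suc k) - 1) \<le> K * norm (t ^ Suc k)"
      unfolding K_def t_def by (rule norm_q_exp_value_minus_1_le)
    also have "\<dots> \<le> K * norm t ^ k"
      using \<open>norm (t ^ Suc k) \<le> norm t ^ k\<close> K by (rule mult_left_mono)
    finally have "real k * norm (q_exp_value q (t ^ Suc k) - 1) \<le> K * (real k * norm t ^ k)"
      using mult_left_mono[of _ "K * norm t ^ k" "real k"] by (simp add: mult.left_commute)
    then show ?thesis
      using norm_power_minus_1_le[of "q_exp_value q (t ^ Suc k)" k] by (meson diff_right_mono exp_le_cancel_iff order.trans)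
  qed
  have "(\<lambda>k. real k * norm t ^ k) \<longlonglongrightarrow> 0"
    using t powser_times_n_limit_0[of "norm t"] by simp
  then have "(\<lambda>k. exp (K * (real k * norm t ^ k)) - 1) \<longlonglongrightarrow> exp (K * 0) - 1"
    by (rule tendsto_diff[OF tendsto_exp[OF tendsto_mult[OF tendsto_const]] tendsto_const])
  then have "(\<lambda>k. exp (K * (real k * norm t ^ k)) - 1) \<longlonglongrightarrow> 0" by simp
  then have "(\<lambda>k. q_exp_value q (t ^ Suc k) ^ k - 1) \<longlonglongrightarrow> 0"
    by (rule Lim_null_comparison[OF always_eventually[OF allI[OF le]]])
  then show ?thesis unfolding t_def by (simp only: LIM_zero_iff)
qed

lemma tendsto_prod_product_factor: "(\<lambda>k. \<Prod>n<k. product_factor q n) \<longlonglongrightarrow> prodinf (product_factor q)"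
  using convergent_prod_LIMSEQ[OF convergent_prod_product_factor[OF q]]
  unfolding lessThan_Suc_atMost[symmetric] by (rule LIMSEQ_imp_Suc)

lemma rank_gf_value_eq_symbol_coeff:
  "rank_gf_value m q = symbol_coeff (q_exp (q\<^sup>2) (q\<^sup>2)) (q_exp q (q\<^sup>2)) m"
  unfolding rank_gf_value_def by (rule infsumI[OF has_sum_rank_gf_value[OF q]])

lemma toeplitz_det_analytic_limit:
  assumes q0: "q \<noteq> 0"
  shows "(\<lambda>k. toeplitz_det k (\<lambda>m. rank_gf_value m q)) \<longlonglongrightarrow> prodinf (product_factor q)"
proof -
  define t where "t = q\<^sup>2"
  have t: "norm t < 1" unfolding t_def by (rule norm_square_less_1[OF q])
  have tq: "norm t \<le> norm q"
    using q by (simp add: t_def power2_eq_square norm_mult mult_left_le_one_le)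
  define C where "C = exp (1 / (1 - norm t)\<^sup>2)"
  define F where "F k = (\<Prod>s<k. geometric_fps (t * t ^ s))" for k
  define f where "f = q_exp t t"
  define g where "g = q_exp q t"
  have decay: "C * norm t ^ m \<le> C * norm q ^ m" for m
    using tq by (intro mult_left_mono power_mono) (auto simp: C_def)
  have "(\<lambda>k. toeplitz_det k (symbol_coeff (F k) g) - toeplitz_det k (symbol_coeff f g)) \<longlonglongrightarrow> 0"
  \<comment> \<open>\<open>f\<close> decays at rate \<open>norm t\<close> and \<open>g\<close> at
    rate \<open>norm q\<close>; the larger one, \<open>norm q\<close>, serves for both and for their
    inverses.\<close>
  proof (rule toeplitz_det_symbol_perturbation[where r = "norm q" and C = C and p = "inverse f" and \<gamma> = "inverse g"
        and D = "\<lambda>k. C\<^sup>2 / (1 - norm t) * norm t ^ k"])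
    show "inverse f * f = 1" "inverse g * g = 1"
      by (simp_all only: f_def g_def inverse_q_exp_mult)
    show "fps_nth (inverse f) 0 = 1" "fps_nth (inverse g) 0 = 1" by (simp_all add: f_def g_def)
    show "norm (fps_nth f m) \<le> C * norm q ^ m" for m
      unfolding f_def using order.trans[OF norm_q_exp_le[OF t] decay[unfolded C_def]] by (simp add: C_def)
    show "norm (fps_nth (inverse f) m) \<le> C * norm q ^ m" for m
      unfolding f_def using order.trans[OF norm_inverse_q_exp_le[OF t] decay[unfolded C_def]] by (simp add: C_def)
    show "norm (fps_nth g m) \<le> C * norm q ^ m" for m
      unfolding g_def C_def by (rule norm_q_exp_le[OF t])
    show "norm (fps_nth (inverse g) m) \<le> C * norm q ^ m" for m
      unfolding g_def C_def by (rule norm_inverse_q_exp_le[OF t])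
    show "norm (fps_nth (F k) m - fps_nth f m) \<le> C\<^sup>2 / (1 - norm t) * norm t ^ k" for k m
      unfolding F_def f_def C_def by (rule norm_prod_geometric_minus_q_exp_le[OF t t])
    have "(\<lambda>k. real k * norm q ^ k) \<longlonglongrightarrow> 0"
      using q powser_times_n_limit_0[of "norm q"] by simp
    then have "(\<lambda>k. C\<^sup>2 / (1 - norm t) * (real k * norm q ^ k)\<^sup>2) \<longlonglongrightarrow> C\<^sup>2 / (1 - norm t) * 0\<^sup>2"
      by (rule tendsto_mult[OF tendsto_const tendsto_power])
    \<comment> \<open>As \<open>norm t\<close> is the square of \<open>norm q\<close>, the factor
      \<open>(real k)\<^sup>2\<close> is absorbed by squaring
      \<open>real k * norm q ^ k\<close>.\<close>
    moreover have "(real k)\<^sup>2 * (C\<^sup>2 / (1 - norm t) * norm t ^ k) = C\<^sup>2 / (1 - norm t) * (real k * norm q ^ k)\<^sup>2" for k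
      by (simp add: t_def norm_power power_mult_distrib power_mult[symmetric] mult.commute)
    ultimately show "(\<lambda>k. (real k)\<^sup>2 * (C\<^sup>2 / (1 - norm t) * norm t ^ k)) \<longlonglongrightarrow> 0"
      by (simp only: zero_power2 mult_zero_right)
  qed (use q in auto)
  moreover have "(\<lambda>k. toeplitz_det k (symbol_coeff (F k) g)) \<longlonglongrightarrow> prodinf (product_factor q) * 1"
    unfolding F_def g_def t_def toeplitz_det_truncated_symbol[OF q0] prod_q_exp_value
    by (rule tendsto_mult[OF tendsto_prod_product_factor tendsto_q_exp_value_power])
  ultimately have "(\<lambda>k. toeplitz_det k (symbol_coeff (F k) g)
      - (toeplitz_det k (symbol_coeff (F k) g) - toeplitz_det k (symbol_coeff f g))) \<longlonglongrightarrow> prodinf (product_factor q) * 1 - 0"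
    by (intro tendsto_diff)
  then show ?thesis
    by (simp add: rank_gf_value_eq_symbol_coeff f_def g_def t_def)
qed

end

text \<open>At this point all nodes collapse to 0, but \<open>f\<close> and \<open>g\<close> are
  both 1, so the matrices are unipotent and every factor of the product is 1.\<close>

lemma toeplitz_det_analytic_limit_0: "(\<lambda>k. toeplitz_det k (\<lambda>m. rank_gf_value m 0)) \<longlonglongrightarrow> prodinf (product_factor 0)"
proof -
  have "q_exp 0 0 = 1"
    by (rule fps_ext) (simp add: q_exp_def power_0_left)
  moreover have "symbol_coeff 1 1 m = int_coeff 1 m" for m
  proof -
    have "symbol_coeff 1 1 m = (\<Sum>l\<in>{0}. int_coeff 1 (m + int l) * fps_nth 1 l)"
      unfolding symbol_coeff_def by (rule suminf_finite) auto
    then show ?thesis by simp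
  qed
  ultimately have "rank_gf_value m 0 = int_coeff 1 m" for m
    by (simp add: rank_gf_value_eq_symbol_coeff)
  then have "toeplitz_det k (\<lambda>m. rank_gf_value m 0) = 1" for k
    using toeplitz_det_unipotent[of "1 :: complex fps" k] by simp
  moreover have "product_factor 0 = (\<lambda>n. 1)"
    by (simp add: product_factor_def fun_eq_iff)
  ultimately show ?thesis by simp
qed

text \<open>The summability clause certifies that \<open>rank_gf_value\<close> is a genuine sum and
  not the default value of \<open>infsum\<close>; the two \<open>convergent_prod\<close> clauses do
  the same for \<open>prodinf\<close>.\<close>

theorem theorem8p2:
  shows "(convergent_prod product_factor_fps \<and>
          (\<forall>N. \<forall>\<^sub>F k in sequentially.
             fps_nth (toeplitz_det k rank_gf) N = fps_nth (prodinf product_factor_fps) N)) \<and>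
         (\<forall>q :: complex. norm q < 1 \<longrightarrow>
           (\<forall>m. (\<lambda>p. q ^ sum_mset p) summable_on partitions_of_rank m) \<and>
           convergent_prod (product_factor q) \<and>
           (\<lambda>k. toeplitz_det k (\<lambda>m. rank_gf_value m q)) \<longlonglongrightarrow> prodinf (product_factor q))"
proof (intro conjI[OF toeplitz_det_formal_limit] allI impI conjI)
  fix q :: complex and m :: int
  assume q: "norm q < 1"
  show "(\<lambda>p. q ^ sum_mset p) summable_on partitions_of_rank m"
    using has_sum_rank_gf_value[OF q] by (rule has_sum_imp_summable)
  show "convergent_prod (product_factor q)"
    by (rule convergent_prod_product_factor[OF q])
  show "(\<lambda>k. toeplitz_det k (\<lambda>m. rank_gf_value m q)) \<longlonglongrightarrow> prodinf (product_factor q)"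
    using toeplitz_det_analytic_limit_0 toeplitz_det_analytic_limit[OF q] by (cases "q = 0") auto
qed

end
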